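(* Let $\alpha_0,\lambda_0\in\mathbb R$ and let $u\in\mathcal S(\mathbb R)$ satisfy $\|u\|_{L^2(\mathbb R)}=1$, $u(x)=0$ if and only if $x=\lambda_0$, and $1+\alpha_0\gamma(|u|^2,\lambda_0)=0$. For $\alpha\in\mathbb R$ let $H_\alpha=M_x+\alpha\langle\cdot,u\rangle u$ on $L^2(\mathbb R)$. Then there exists $\delta>0$ such that $$\tau_\alpha(\phi)>\frac{\|\phi\|^4}{4\kappa(\alpha)}\qquad\text{for } 0<|\alpha-\alpha_0|<\delta .$$
   Context: The inner product is linear in its first argument. $M_x$ is the self-adjoint operator of multiplication by $x$ on $L^2(\mathbb R)$, with maximal domain; $H_\alpha$ has the same domain. For $f\in\mathcal S(\mathbb R)$, $\lambda\in\mathbb R$, $\gamma(f,\lambda)=\lim_{\epsilon\to0^+}\int_{|x-\lambda|\ge\epsilon}\frac{f(x)}{x-\lambda}\,dx$ (Cauchy principal value). Put $F_1(\alpha,\lambda)=1+\alpha\gamma(|u|^2,\lambda)$. The function $\phi$ is defined by $\phi(x)=u(x)/(x-\lambda_0)$ for $x\ne\lambda_0$ and $\phi(\lambda_0)=u'(\lambda_0)$; it belongs to $\mathcal S(\mathbb R)$ and is an eigenvector of $H_{\alpha_0}$ for the simple eigenvalue $\lambda_0$. Let $J$ be an open interval around $\alpha_0$ and $\lambda:J\to\mathbb R$, $\alpha\mapsto\lambda(\alpha)$, a $C^1$ function with $\lambda(\alpha_0)=\lambda_0$ and $F_1(\alpha,\lambda(\alpha))=0$ for $\alpha\in J$ (these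 exist by the implicit function theorem). For $\alpha\in J$ set $\kappa(\alpha)=\pi|u(\lambda(\alpha))|^2/\|\phi\|^2$; $\kappa(\alpha)>0$ for $\alpha\in J\setminus\{\alpha_0\}$ and $\kappa(\alpha_0)=0$. The number $\delta$ is understood small enough that $(\alpha_0-\delta,\alpha_0+\delta)\subset J$. The sojourn time of $v\in L^2(\mathbb R)$ is $\tau_\alpha(v)=\int_{-\infty}^\infty|\langle e^{-itH_\alpha}v,v\rangle|^2\,dt$. *)

theory Defs
  imports "HOL-Analysis.Analysis"
begin

section \<open>The Hilbert space of square-integrable functions on the line\<close>

definition sq_integrable :: "(real \<Rightarrow> complex) \<Rightarrow> bool" where
  "sq_integrable f \<longleftrightarrow>
     f \<in> borel_measurable lborel \<and> integrable lborel (\<lambda>x. (cmod (f x))\<^sup>2)"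

definition L2_rel :: "(real \<Rightarrow> complex) \<Rightarrow> (real \<Rightarrow> complex) \<Rightarrow> bool" where
  "L2_rel f g \<longleftrightarrow> sq_integrable f \<and> sq_integrable g \<and> (AE x in lborel. f x = g x)"

lemma sq_integrable_zero [simp]: "sq_integrable (\<lambda>x. 0)"
  by (simp add: sq_integrable_def)

lemma sq_integrable_mult_cnj:
  assumes "sq_integrable f" "sq_integrable g"
  shows "integrable lborel (\<lambda>x. f x * cnj (g x))"
proof (rule Bochner_Integration.integrable_bound)
  show "integrable lborel (\<lambda>x. (cmod (f x))\<^sup>2 + (cmod (g x))\<^sup>2)"
    using assms by (auto simp: sq_integrable_def)
  have [measurable]: "f \<in> borel_measurable borel" "g \<in> borel_measurable borel"
    using assms by (auto simp: sq_integrable_def)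
  have [measurable]: "(\<lambda>x. cnj (g x)) \<in> borel_measurable borel"
    by (rule borel_measurable_continuous_on[of cnj g borel]) (auto intro: continuous_intros)
  show "(\<lambda>x. f x * cnj (g x)) \<in> borel_measurable lborel"
    by measurable
  have "cmod a * cmod b \<le> (cmod a)\<^sup>2 + (cmod b)\<^sup>2" for a b
  proof -
    have "2 * (cmod a * cmod b) \<le> (cmod a)\<^sup>2 + (cmod b)\<^sup>2"
      using sum_squares_bound[of "cmod a" "cmod b"] by (simp add: mult.assoc)
    moreover have "0 \<le> cmod a * cmod b" by simp
    ultimately show ?thesis by linarith
  qed
  then show "AE x in lborel. norm (f x * cnj (g x)) \<le> norm ((cmod (f x))\<^sup>2 + (cmod (g x))\<^sup>2)"
    by (auto simp: norm_mult)
qed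

lemma sq_integrable_add:
  assumes "sq_integrable f" "sq_integrable g"
  shows "sq_integrable (\<lambda>x. f x + g x)"
  unfolding sq_integrable_def
proof
  have [measurable]: "f \<in> borel_measurable borel" "g \<in> borel_measurable borel"
    using assms by (auto simp: sq_integrable_def)
  show meas: "(\<lambda>x. f x + g x) \<in> borel_measurable lborel"
    by measurable
  show "integrable lborel (\<lambda>x. (cmod (f x + g x))\<^sup>2)"
  proof (rule Bochner_Integration.integrable_bound)
    show "integrable lborel (\<lambda>x. 2 * (cmod (f x))\<^sup>2 + 2 * (cmod (g x))\<^sup>2)"
      using assms by (auto simp: sq_integrable_def)
    show "(\<lambda>x. (cmod (f x + g x))\<^sup>2) \<in> borel_measurable lborel"
      using meas by measurable
    have "(cmod (a + b))\<^sup>2 \<le> 2 * (cmod a)\<^sup>2 + 2 * (cmod b)\<^sup>2" for a b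
    proof -
      have "(cmod (a + b))\<^sup>2 \<le> (cmod a + cmod b)\<^sup>2"
        by (intro power_mono norm_triangle_ineq) simp
      also have "\<dots> \<le> 2 * (cmod a)\<^sup>2 + 2 * (cmod b)\<^sup>2"
        using sum_squares_bound[of "cmod a" "cmod b"] by (simp add: power2_sum)
      finally show ?thesis .
    qed
    then show "AE x in lborel. norm ((cmod (f x + g x))\<^sup>2)
        \<le> norm (2 * (cmod (f x))\<^sup>2 + 2 * (cmod (g x))\<^sup>2)"
      by simp
  qed
qed

lemma sq_integrable_cmult:
  assumes "sq_integrable f"
  shows "sq_integrable (\<lambda>x. c * f x)"
  using assms by (auto simp: sq_integrable_def norm_mult power_mult_distrib)

quotient_type L2 = "real \<Rightarrow> complex" / partial: L2_rel
  morphisms rep_L2 Abs_L2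
proof (rule part_equivpI)
  show "\<exists>f. L2_rel f f"
    by (rule exI[of _ "\<lambda>x. 0"]) (simp add: L2_rel_def)
  show "symp L2_rel"
    by (auto simp: symp_def L2_rel_def eq_commute)
  show "transp L2_rel"
    unfolding transp_def L2_rel_def by (auto elim: AE_mp)
qed

lemma L2_relD:
  assumes "L2_rel f g"
  shows "sq_integrable f" "sq_integrable g" "AE x in lborel. f x = g x"
  using assms by (auto simp: L2_rel_def)

lift_definition cscale :: "complex \<Rightarrow> L2 \<Rightarrow> L2" is "\<lambda>c f x. c * f x"
  unfolding L2_rel_def by (auto intro: sq_integrable_cmult)

lift_definition cinner :: "L2 \<Rightarrow> L2 \<Rightarrow> complex"
  is "\<lambda>f g. LINT x|lborel. f x * cnj (g x)"
proof -
  fix f f' g g' assume fg: "L2_rel f f'" "L2_rel g g'"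
  then have "AE x in lborel. f x * cnj (g x) = f' x * cnj (g' x)"
    unfolding L2_rel_def by auto
  moreover have "(\<lambda>x. f x * cnj (g x)) \<in> borel_measurable lborel"
    "(\<lambda>x. f' x * cnj (g' x)) \<in> borel_measurable lborel"
    using fg by (simp_all add: L2_rel_def sq_integrable_mult_cnj borel_measurable_integrable
        del: measurable_lborel1 measurable_lborel2)
  ultimately show "(LINT x|lborel. f x * cnj (g x)) = (LINT x|lborel. f' x * cnj (g' x))"
    by (intro integral_cong_AE)
qed

instantiation L2 :: real_inner
begin

lift_definition zero_L2 :: L2 is "\<lambda>x. 0"
  by (simp add: L2_rel_def)

lift_definition plus_L2 :: "L2 \<Rightarrow> L2 \<Rightarrow> L2" is "\<lambda>f g x. f x + g x"
  unfolding L2_rel_def by (auto intro: sq_integrable_add)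

definition uminus_L2 :: "L2 \<Rightarrow> L2" where "uminus_L2 v = cscale (-1) v"
definition minus_L2 :: "L2 \<Rightarrow> L2 \<Rightarrow> L2" where "minus_L2 v w = v + (- w)"
definition scaleR_L2 :: "real \<Rightarrow> L2 \<Rightarrow> L2" where "scaleR_L2 r v = cscale (complex_of_real r) v"
definition inner_L2 :: "L2 \<Rightarrow> L2 \<Rightarrow> real" where "inner_L2 v w = Re (cinner v w)"
definition norm_L2 :: "L2 \<Rightarrow> real" where "norm_L2 v = sqrt (inner v v)"
definition sgn_L2 :: "L2 \<Rightarrow> L2" where "sgn_L2 v = inverse (norm v) *\<^sub>R v"
definition dist_L2 :: "L2 \<Rightarrow> L2 \<Rightarrow> real" where "dist_L2 v w = norm (v - w)"
definition uniformity_L2 :: "(L2 \<times> L2) filter" where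
  "uniformity_L2 = (INF e\<in>{0<..}. principal {(x, y). dist x y < e})"
definition open_L2 :: "L2 set \<Rightarrow> bool" where
  "open_L2 U = (\<forall>x\<in>U. \<forall>\<^sub>F (x', y) in uniformity. x' = x \<longrightarrow> y \<in> U)"

lemma cinner_self_ge_0: "0 \<le> Re (cinner v v)"
proof (transfer)
  fix f assume "L2_rel f f"
  have "(LINT x|lborel. f x * cnj (f x)) = (LINT x|lborel. complex_of_real ((cmod (f x))\<^sup>2))"
    by (simp only: complex_norm_square)
  then show "0 \<le> Re (LINT x|lborel. f x * cnj (f x))"
    by (simp only: integral_complex_of_real) simp
qed

lemma cinner_self_eq_0: "Re (cinner v v) = 0 \<longleftrightarrow> v = 0"
proof (transfer)
  fix f assume "L2_rel f f"
  then have f: "sq_integrable f" by (simp add: L2_rel_def)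
  have "(LINT x|lborel. f x * cnj (f x)) = (LINT x|lborel. complex_of_real ((cmod (f x))\<^sup>2))"
    by (simp only: complex_norm_square)
  then have "Re (LINT x|lborel. f x * cnj (f x)) = (LINT x|lborel. (cmod (f x))\<^sup>2)"
    by (simp only: integral_complex_of_real) simp
  also have "\<dots> = 0 \<longleftrightarrow> (AE x in lborel. (cmod (f x))\<^sup>2 = 0)"
    using f by (intro integral_nonneg_eq_0_iff_AE) (auto simp: sq_integrable_def)
  also have "\<dots> \<longleftrightarrow> L2_rel f (\<lambda>x. 0)"
    using f by (simp add: L2_rel_def)
  finally show "Re (LINT x|lborel. f x * cnj (f x)) = 0 \<longleftrightarrow> L2_rel f (\<lambda>x. 0)" .
qed

lemma cinner_commute: "cinner v w = cnj (cinner w v)"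
proof (transfer)
  fix f g
  show "(LINT x|lborel. f x * cnj (g x)) = cnj (LINT x|lborel. g x * cnj (f x))"
    by (subst Bochner_Integration.integral_cnj [symmetric])
      (simp add: mult.commute del: Bochner_Integration.integral_cnj)
qed

lemma cinner_add_left: "cinner (v + v') w = cinner v w + cinner v' w"
proof (transfer)
  fix f g h assume "L2_rel f f" "L2_rel g g" "L2_rel h h"
  then show "(LINT x|lborel. (f x + g x) * cnj (h x)) =
      (LINT x|lborel. f x * cnj (h x)) + (LINT x|lborel. g x * cnj (h x))"
    by (simp add: distrib_right L2_rel_def sq_integrable_mult_cnj)
qed

lemma cinner_cscale_left: "cinner (cscale c v) w = c * cinner v w"
  by transfer (simp add: mult.assoc)

instance
proof
  fix u v w :: L2 and r s :: real
  show "u + v + w = u + (v + w)"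
    by transfer (simp add: add.assoc L2_rel_def sq_integrable_add)
  show "u + v = v + u"
    by transfer (simp add: add.commute L2_rel_def sq_integrable_add)
  show "0 + u = u"
    by transfer simp
  show "- u + u = 0"
    unfolding uminus_L2_def by transfer (simp add: L2_rel_def)
  show "u - v = u + - v"
    by (rule minus_L2_def)
  show "r *\<^sub>R (u + v) = r *\<^sub>R u + r *\<^sub>R v"
    unfolding scaleR_L2_def
    by transfer (simp add: distrib_left L2_rel_def sq_integrable_add sq_integrable_cmult)
  show "(r + s) *\<^sub>R u = r *\<^sub>R u + s *\<^sub>R u"
    unfolding scaleR_L2_def
    by transfer (simp add: distrib_right L2_rel_def sq_integrable_add sq_integrable_cmult)
  show "r *\<^sub>R s *\<^sub>R u = (r * s) *\<^sub>R u"
    unfolding scaleR_L2_def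
    by transfer (simp add: mult.assoc L2_rel_def sq_integrable_cmult)
  show "1 *\<^sub>R u = u"
    unfolding scaleR_L2_def by transfer simp
  show "sgn u = inverse (norm u) *\<^sub>R u"
    by (rule sgn_L2_def)
  show "dist u v = norm (u - v)"
    by (rule dist_L2_def)
  show "uniformity = (INF e\<in>{0<..}. principal {(x :: L2, y). dist x y < e})"
    by (rule uniformity_L2_def)
  fix U :: "L2 set"
  show "open U = (\<forall>x\<in>U. \<forall>\<^sub>F (x', y) in uniformity. x' = x \<longrightarrow> y \<in> U)"
    by (rule open_L2_def)
  show "inner u v = inner v u"
    unfolding inner_L2_def by (subst cinner_commute) simp
  show "inner (u + v) w = inner u w + inner v w"
    by (simp add: inner_L2_def cinner_add_left)
  show "inner (r *\<^sub>R u) v = r * inner u v"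
    by (simp add: inner_L2_def scaleR_L2_def cinner_cscale_left)
  show "0 \<le> inner u u"
    by (simp add: inner_L2_def cinner_self_ge_0)
  show "inner u u = 0 \<longleftrightarrow> u = 0"
    by (simp add: inner_L2_def cinner_self_eq_0)
  show "norm u = sqrt (inner u u)"
    by (rule norm_L2_def)
qed

end

section \<open>Unbounded operators and the group they generate\<close>

text \<open>An operator with a domain is a partial map: \<open>dom H\<close> is the domain, so that equality of
  operators includes equality of domains.\<close>

definition unitary_op :: "(L2 \<Rightarrow> L2) \<Rightarrow> bool" where
  "unitary_op T \<longleftrightarrow>
     (\<forall>v w. T (v + w) = T v + T w) \<and> (\<forall>c v. T (cscale c v) = cscale c (T v)) \<and>
     (\<forall>v w. cinner (T v) (T w) = cinner v w) \<and> surj T"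

definition unitary_group :: "(real \<Rightarrow> L2 \<Rightarrow> L2) \<Rightarrow> bool" where
  "unitary_group U \<longleftrightarrow>
     (\<forall>t. unitary_op (U t)) \<and> U 0 = id \<and> (\<forall>s t. U (s + t) = U s \<circ> U t) \<and>
     (\<forall>v. continuous_on UNIV (\<lambda>t. U t v))"

text \<open>The factor \<open>\<i>\<close> makes \<open>generator U\<close> the operator \<open>H\<close> with
  \<open>(d/dt) U(t)v = - \<i> H U(t)v\<close>; its domain consists of all \<open>v\<close> for which the strong
  derivative at 0 exists.\<close>

definition generator :: "(real \<Rightarrow> L2 \<Rightarrow> L2) \<Rightarrow> (L2 \<rightharpoonup> L2)" where
  "generator U v =
     (if \<exists>w. ((\<lambda>t. (U t v - v) /\<^sub>R t) \<longlongrightarrow> w) (at 0)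
      then Some (cscale \<i> (Lim (at 0) (\<lambda>t. (U t v - v) /\<^sub>R t))) else None)"

text \<open>By Stone's theorem, for self-adjoint \<open>H\<close> there is exactly one strongly continuous unitary
  group with generator \<open>H\<close>, namely \<open>t \<mapsto> e\<^sup>-\<^sup>i\<^sup>t\<^sup>H\<close>.\<close>

definition exp_group :: "(L2 \<rightharpoonup> L2) \<Rightarrow> real \<Rightarrow> L2 \<Rightarrow> L2" where
  "exp_group H = (THE U. unitary_group U \<and> generator U = H)"

text \<open>Sojourn time with respect to \<open>H\<close>, with values in the extended half-line.\<close>

definition sojourn_time :: "(L2 \<rightharpoonup> L2) \<Rightarrow> L2 \<Rightarrow> ennreal" where
  "sojourn_time H v = (\<integral>\<^sup>+t. ennreal ((cmod (cinner (exp_group H t v) v))\<^sup>2) \<partial>lborel)"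

text \<open>The class of a function; the junk value for functions that are not square-integrable
  is 0.\<close>

definition L2_of :: "(real \<Rightarrow> complex) \<Rightarrow> L2" where
  "L2_of f = (if sq_integrable f then Abs_L2 f else 0)"

text \<open>The choice of the representative \<open>rep_L2 v\<close> is immaterial: both the case distinction and
  the resulting class depend only on \<open>v\<close>.\<close>

definition mult_x :: "L2 \<rightharpoonup> L2" where
  "mult_x v =
     (let f = (\<lambda>x. complex_of_real x * rep_L2 v x)
      in if sq_integrable f then Some (L2_of f) else None)"

definition H_op :: "L2 \<Rightarrow> real \<Rightarrow> (L2 \<rightharpoonup> L2)" where
  "H_op u \<alpha> v = map_option (\<lambda>w. w + cscale (complex_of_real \<alpha> * cinner v u) u) (mult_x v)"

section \<open>Schwartz functions, principal values and the data of the problem\<close>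

definition schwartz :: "(real \<Rightarrow> complex) \<Rightarrow> bool" where
  "schwartz f \<longleftrightarrow>
     (\<exists>D. D 0 = f \<and> (\<forall>n x. (D n has_vector_derivative D (Suc n) x) (at x)) \<and>
        (\<forall>k n. bounded (range (\<lambda>x. x ^ k *\<^sub>R D n x))))"

definition pv :: "(real \<Rightarrow> 'a::{real_normed_field, banach, second_countable_topology}) \<Rightarrow> real \<Rightarrow> 'a"
  where "pv f l = Lim (at_right 0)
     (\<lambda>\<epsilon>. LINT x:{x. \<epsilon> \<le> \<bar>x - l\<bar>}|lborel. f x / of_real (x - l))"

definition F1 :: "(real \<Rightarrow> complex) \<Rightarrow> real \<Rightarrow> real \<Rightarrow> real" where
  "F1 u \<alpha> l = 1 + \<alpha> * pv (\<lambda>x. (cmod (u x))\<^sup>2) l"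

definition phi :: "(real \<Rightarrow> complex) \<Rightarrow> real \<Rightarrow> real \<Rightarrow> complex" where
  "phi u l0 x =
     (if x = l0 then vector_derivative u (at l0) else u x / complex_of_real (x - l0))"

definition kappa :: "(real \<Rightarrow> complex) \<Rightarrow> real \<Rightarrow> (real \<Rightarrow> real) \<Rightarrow> real \<Rightarrow> real" where
  "kappa u l0 lam \<alpha> = pi * (cmod (u (lam \<alpha>)))\<^sup>2 / (norm (L2_of (phi u l0)))\<^sup>2"

end

(*
  Let N = ||phi||^2, A(z) = int |phi|^2/(x - z), B = N + (z - lambda_0) A and
  F = 1 + alpha int |u|^2/(x - z).  Krein's formula gives <(H_alpha - z)^-1 phi, phi> = A - alpha B^2 / F.
  Take z = lambda(alpha) + i kappa(alpha).  Since |phi|^2 has bounded second differences, A(z) differs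
  from its boundary value by O(kappa), however fast kappa tends to 0; with F_1(alpha, lambda(alpha)) = 0
  this yields F = 2 i alpha kappa N + o(alpha kappa) and B = N + o(1), so kappa |<(H_alpha - z)^-1 phi, phi>| tends
  to N/2.  As this resolvent element is a Laplace transform of <exp(-itH) phi, phi>, the Cauchy-Schwarz
  inequality bounds it by N/(4 kappa) if the sojourn time is at most N^2/(4 kappa), a contradiction.

  The unitary group of H_alpha is obtained by solving, in the interaction picture, the linear
  evolution equation W' = -i alpha <W, e> e with e(t) = exp(itx) u.
*)
theory Submission
  imports Defs
begin

section \<open>The space of square-integrable functions\<close>

text \<open>The obstacle is that u may vanish at lambda_0 to any order, even infinite. With d =
  lambda(alpha) - lambda_0, nothing bounds kappa from below by a power of d, so every error has to
  be compared with kappa itself. The factorisation u = (x - lambda_0) phi makes this possible: kappa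
  N = d^2 pi |phi(lambda(alpha))|^2 is exactly the imaginary part of the boundary value of F /
  alpha, and the O(kappa) error of A enters F only with the factor d^2. Moving from the axis up to
  height kappa contributes a second i kappa N, whence the factor 2 in F. Since N/2 and N/4 differ by
  a factor of two, relative errors of one tenth are affordable, and the argument runs with explicit
  inequalities in place of limits.

  The group has to be constructed because \<open>exp_group\<close> is a definite description: it
  carries information only after existence and uniqueness are known. For a rank-one perturbation of
  a multiplication operator both can be had by elementary means, without a spectral theorem.\<close>

lemma sq_integrable_rep [simp]: "sq_integrable (rep_L2 v)"
  using Quotient_rep_reflp[OF Quotient_L2] by (auto simp: L2_rel_def)

lemma L2_of_rep [simp]: "L2_of (rep_L2 v) = v"
  by (simp add: L2_of_def Quotient_abs_rep[OF Quotient_L2])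

lemma L2_of_eqI: "sq_integrable f \<Longrightarrow> sq_integrable g \<Longrightarrow> AE x in lborel. f x = g x \<Longrightarrow> L2_of f = L2_of g"
  using Quotient_rel_abs[OF Quotient_L2] by (auto simp: L2_of_def L2_rel_def)

lemma L2_of_eqD: "sq_integrable f \<Longrightarrow> sq_integrable g \<Longrightarrow> L2_of f = L2_of g \<Longrightarrow> AE x in lborel. f x = g x"
  using Quotient_rel[OF Quotient_L2, of f g] by (auto simp: L2_of_def L2_rel_def)

lemma rep_L2_of: "sq_integrable f \<Longrightarrow> AE x in lborel. rep_L2 (L2_of f) x = f x"
  by (rule L2_of_eqD) auto

lemma L2_of_add: "sq_integrable f \<Longrightarrow> sq_integrable g \<Longrightarrow> L2_of (\<lambda>x. f x + g x) = L2_of f + L2_of g"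
  by (simp add: L2_of_def sq_integrable_add plus_L2.abs_eq L2_rel_def)

lemma L2_of_cscale: "sq_integrable f \<Longrightarrow> L2_of (\<lambda>x. c * f x) = cscale c (L2_of f)"
  by (simp add: L2_of_def sq_integrable_cmult cscale.abs_eq L2_rel_def)

lemma cinner_L2_of: "sq_integrable f \<Longrightarrow> sq_integrable g \<Longrightarrow>
    cinner (L2_of f) (L2_of g) = (LINT x|lborel. f x * cnj (g x))"
  by (simp add: L2_of_def cinner.abs_eq L2_rel_def)

lemma sq_integrable_diff: "sq_integrable f \<Longrightarrow> sq_integrable g \<Longrightarrow> sq_integrable (\<lambda>x. f x - g x)"
  using sq_integrable_add[of f "\<lambda>x. -1 * g x"] sq_integrable_cmult[of g "-1"] by simp

lemma L2_of_diff: "sq_integrable f \<Longrightarrow> sq_integrable g \<Longrightarrow> L2_of (\<lambda>x. f x - g x) = L2_of f - L2_of g"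
  using L2_of_add[of f "\<lambda>x. -1 * g x"] L2_of_cscale[of g "-1"] sq_integrable_cmult[of g "-1"]
  by (simp add: minus_L2_def uminus_L2_def)

lemma cinner_self: "cinner v v = of_real ((norm v)\<^sup>2)"
proof -
  have "Im (cinner v v) = 0"
    using cinner_commute[of v v] by (metis complex_cnj_cancel_iff complex_cnj cnj.simps(2) neg_equal_zero)
  moreover have "Re (cinner v v) = (norm v)\<^sup>2"
    by (simp add: norm_L2_def inner_L2_def[symmetric])
  ultimately show ?thesis by (simp add: complex_eq_iff)
qed

lemma norm_L2_of: "sq_integrable f \<Longrightarrow> (norm (L2_of f))\<^sup>2 = (LINT x|lborel. (cmod (f x))\<^sup>2)"
proof -
  assume f: "sq_integrable f"
  have "of_real ((norm (L2_of f))\<^sup>2) = (LINT x|lborel. complex_of_real ((cmod (f x))\<^sup>2))"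
    using cinner_L2_of[OF f f] by (simp only: cinner_self complex_norm_square)
  then show ?thesis by (simp only: integral_complex_of_real of_real_eq_iff)
qed

lemma cinner_add_right: "cinner v (w + w') = cinner v w + cinner v w'"
  by (metis cinner_commute cinner_add_left complex_cnj_add)

lemma cinner_cscale_right: "cinner v (cscale c w) = cnj c * cinner v w"
  by (metis cinner_commute cinner_cscale_left complex_cnj_mult)

lemma scaleR_cscale: "r *\<^sub>R v = cscale (of_real r) v"
  by (simp add: scaleR_L2_def)

lemma cscale_cscale [simp]: "cscale a (cscale b v) = cscale (a * b) v"
  by (subst (1 2 3) L2_of_rep[symmetric], unfold L2_of_cscale[OF sq_integrable_rep, symmetric])
     (simp add: L2_of_cscale[symmetric] sq_integrable_cmult mult.assoc)

lemma cscale_1 [simp]: "cscale 1 v = v"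
  using scaleR_cscale[of 1 v] by simp

lemma cscale_minus_1: "cscale (- 1) v = - v"
  by (simp add: uminus_L2_def)

lemma cscale_add: "cscale c (v + w) = cscale c v + cscale c w"
proof -
  have "cscale c (L2_of (rep_L2 v) + L2_of (rep_L2 w)) = cscale c (L2_of (rep_L2 v)) + cscale c (L2_of (rep_L2 w))"
    by (simp add: L2_of_add[symmetric] L2_of_cscale[symmetric] sq_integrable_add sq_integrable_cmult
        distrib_left del: L2_of_rep)
  then show ?thesis by simp
qed

lemma cscale_add_left: "cscale (a + b) v = cscale a v + cscale b v"
proof -
  have "cscale (a + b) (L2_of (rep_L2 v)) = cscale a (L2_of (rep_L2 v)) + cscale b (L2_of (rep_L2 v))"
    by (simp add: L2_of_add[symmetric] L2_of_cscale[symmetric] sq_integrable_add sq_integrable_cmult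
        distrib_right del: L2_of_rep)
  then show ?thesis by simp
qed

lemma norm_cscale: "norm (cscale c v) = cmod c * norm v"
proof -
  have "complex_of_real ((norm (cscale c v))\<^sup>2) = of_real ((cmod c * norm v)\<^sup>2)"
    unfolding cinner_self[symmetric] cinner_cscale_left cinner_cscale_right
    by (simp add: cinner_self complex_norm_square[of c, symmetric] power_mult_distrib mult.assoc [symmetric]
        mult.commute [of "cnj c"])
  then show ?thesis by (simp only: of_real_eq_iff power2_eq_iff_nonneg norm_ge_zero mult_nonneg_nonneg)
qed

lemma cinner_scaleR_left: "cinner (r *\<^sub>R v) w = r *\<^sub>R cinner v w"
  by (simp add: scaleR_cscale cinner_cscale_left scaleR_conv_of_real)

lemma cinner_scaleR_right: "cinner v (r *\<^sub>R w) = r *\<^sub>R cinner v w"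
  by (simp add: scaleR_cscale cinner_cscale_right scaleR_conv_of_real)

text \<open>A unimodular factor on \<open>v\<close> turns the complex inner product into its
  modulus; what remains is the real inequality for \<open>inner\<close>, the real part of
  \<open>cinner\<close>.\<close>

lemma cinner_Cauchy_Schwarz: "cmod (cinner v w) \<le> norm v * norm w"
proof (cases "cinner v w = 0")
  case False
  define c where "c = cnj (sgn (cinner v w))"
  have "c * cinner v w = of_real (cmod (cinner v w))"
    unfolding c_def sgn_eq using False complex_norm_square[of "cinner v w"]
    by (simp add: field_simps power2_eq_square)
  then have "cmod (cinner v w) = Re (cinner (cscale c v) w)"
    by (simp add: cinner_cscale_left)
  also have "\<dots> = inner (cscale c v) w" by (simp add: inner_L2_def)
  also have "\<dots> \<le> norm (cscale c v) * norm w"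
    by (rule norm_cauchy_schwarz)
  also have "\<dots> = norm v * norm w"
    using False by (simp add: norm_cscale c_def norm_sgn)
  finally show ?thesis .
qed simp

lemma bounded_bilinear_cinner: "bounded_bilinear cinner"
proof
  show "\<exists>K. \<forall>a b. norm (cinner a b) \<le> norm a * norm b * K"
    by (rule exI[of _ 1]) (simp add: cinner_Cauchy_Schwarz)
qed (simp_all add: cinner_add_left cinner_add_right cinner_scaleR_left cinner_scaleR_right)

lemma bounded_bilinear_cscale: "bounded_bilinear cscale"
proof
  show "\<exists>K. \<forall>a b. norm (cscale a b) \<le> norm a * norm b * K"
    by (rule exI[of _ 1]) (simp add: norm_cscale)
  show "cscale a (r *\<^sub>R b) = r *\<^sub>R cscale a b" "cscale (r *\<^sub>R a) b = r *\<^sub>R cscale a b" for a b r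
    by (simp_all add: scaleR_cscale scaleR_conv_of_real mult.commute)
qed (simp_all add: cscale_add cscale_add_left)

interpretation cinner: bounded_bilinear cinner by (rule bounded_bilinear_cinner)
interpretation cscale: bounded_bilinear cscale by (rule bounded_bilinear_cscale)

lemma L2_ennnorm: "sq_integrable f \<Longrightarrow> (\<integral>\<^sup>+x. ennreal ((cmod (f x))\<^sup>2) \<partial>lborel) = ennreal ((norm (L2_of f))\<^sup>2)"
  by (simp add: norm_L2_of nn_integral_eq_integral sq_integrable_def)

lemma sq_integrable_iff_nn:
  "f \<in> borel_measurable lborel \<Longrightarrow>
    sq_integrable f \<longleftrightarrow> (\<integral>\<^sup>+x. ennreal ((cmod (f x))\<^sup>2) \<partial>lborel) < \<infinity>"
  by (auto simp: sq_integrable_def integrable_iff_bounded)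

lemma sq_integrable_measurable: "sq_integrable f \<Longrightarrow> f \<in> borel_measurable borel"
  by (simp add: sq_integrable_def)

lemma sq_integrable_bound:
  assumes "sq_integrable g" "f \<in> borel_measurable borel" "\<And>x. cmod (f x) \<le> cmod (g x)"
  shows "sq_integrable f"
proof -
  have "integrable lborel (\<lambda>x. (cmod (f x))\<^sup>2)"
  proof (rule Bochner_Integration.integrable_bound)
    show "integrable lborel (\<lambda>x. (cmod (g x))\<^sup>2)" using assms by (simp add: sq_integrable_def)
    show "(\<lambda>x. (cmod (f x))\<^sup>2) \<in> borel_measurable lborel" using assms(2) by measurable
  qed (use assms in \<open>auto intro!: power_mono\<close>)
  then show ?thesis using assms by (simp add: sq_integrable_def)
qed

text \<open>Riesz--Fischer: along a subsequence with \<open>\<parallel>f\<^sub>n\<^sub>+\<^sub>1 - f\<^sub>n\<parallel> \<le> 2\<^sup>-\<^sup>n\<close> the weighted sum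
  \<open>\<Sum>n. 2\<^sup>n |f\<^sub>n\<^sub>+\<^sub>1 - f\<^sub>n|\<^sup>2\<close> has finite integral, so it is finite almost everywhere; this forces
  pointwise convergence without using Minkowski's inequality.\<close>

lemma L2_fast_Cauchy_convergent:
  fixes X :: "nat \<Rightarrow> L2"
  assumes "Cauchy X" and fast: "\<And>n. norm (X (Suc n) - X n) \<le> (1/2) ^ n"
  shows "convergent X"
proof -
  define f where "f n = rep_L2 (X n)" for n
  have f [simp]: "sq_integrable (f n)" "L2_of (f n) = X n" for n by (simp_all add: f_def)
  have [measurable]: "f n \<in> borel_measurable borel" for n by (simp add: sq_integrable_measurable)
  define a where "a n x = cmod (f (Suc n) x - f n x)" for n x
  have [measurable]: "a n \<in> borel_measurable borel" for n unfolding a_def by measurable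
  have "(\<integral>\<^sup>+x. (\<Sum>n. ennreal (2 ^ n * (a n x)\<^sup>2)) \<partial>lborel) = (\<Sum>n. \<integral>\<^sup>+x. ennreal (2 ^ n * (a n x)\<^sup>2) \<partial>lborel)"
    by (rule nn_integral_suminf) measurable
  also have "\<dots> \<le> (\<Sum>n. ennreal ((1/2) ^ n))"
  proof (intro suminf_le allI)
    fix n
    have "(\<integral>\<^sup>+x. ennreal (2 ^ n * (a n x)\<^sup>2) \<partial>lborel) = ennreal (2 ^ n) * (\<integral>\<^sup>+x. ennreal ((a n x)\<^sup>2) \<partial>lborel)"
      by (subst nn_integral_cmult[symmetric]) (auto simp: ennreal_mult)
    also have "(\<integral>\<^sup>+x. ennreal ((a n x)\<^sup>2) \<partial>lborel) = ennreal ((norm (X (Suc n) - X n))\<^sup>2)"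
      unfolding a_def by (subst L2_ennnorm) (auto simp: sq_integrable_diff L2_of_diff)
    also have "ennreal (2 ^ n) * \<dots> = ennreal (2 ^ n * (norm (X (Suc n) - X n))\<^sup>2)"
      by (simp add: ennreal_mult)
    also have "\<dots> \<le> ennreal ((1/2) ^ n)"
    proof (rule ennreal_leI)
      have "2 ^ n * (norm (X (Suc n) - X n))\<^sup>2 \<le> 2 ^ n * ((1/2) ^ n)\<^sup>2"
        using fast[of n] by (intro mult_left_mono power_mono) auto
      also have "\<dots> = (1/2::real) ^ n" by (simp add: power2_eq_square power_divide)
      finally show "2 ^ n * (norm (X (Suc n) - X n))\<^sup>2 \<le> (1/2) ^ n" .
    qed
    finally show "(\<integral>\<^sup>+x. ennreal (2 ^ n * (a n x)\<^sup>2) \<partial>lborel) \<le> ennreal ((1/2) ^ n)" .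
  qed auto
  also have "\<dots> = ennreal (\<Sum>n. (1/2) ^ n)"
    by (rule suminf_ennreal2) (auto intro: summable_geometric)
  also have "\<dots> < \<infinity>" by simp
  finally have "AE x in lborel. (\<Sum>n. ennreal (2 ^ n * (a n x)\<^sup>2)) \<noteq> \<infinity>"
    by (intro nn_integral_noteq_infinite) auto
  then have conv: "AE x in lborel. convergent (\<lambda>n. f n x)"
  proof eventually_elim
    fix x assume fin: "(\<Sum>n. ennreal (2 ^ n * (a n x)\<^sup>2)) \<noteq> \<infinity>"
    have "summable (\<lambda>n. 2 ^ n * (a n x)\<^sup>2)"
      using fin by (intro summable_suminf_not_top) (auto simp: top_unique)
    then have s: "summable (\<lambda>n. 2 ^ n * (a n x)\<^sup>2 + (1/2) ^ n)"
      by (intro summable_add summable_geometric) auto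
    have "summable (\<lambda>n. norm (f (Suc n) x - f n x))"
    proof (rule summable_comparison_test'[OF s, of 0])
      fix n
      \<comment> \<open>This is b <= b^2 + 1 for b = \<open>2 ^ n * a n x\<close>, divided by
        \<open>2 ^ n\<close>.\<close>
      have "a n x \<le> 2 ^ n * (a n x)\<^sup>2 + (1/2) ^ n"
      proof -
        have "0 \<le> (2 ^ n * a n x - 1)\<^sup>2 + 2 ^ n * a n x" by (simp add: a_def)
        then have "2 ^ n * a n x \<le> (2 ^ n)\<^sup>2 * (a n x)\<^sup>2 + 1"
          by (simp add: power2_eq_square algebra_simps)
        then have "(1/2)^n * (2 ^ n * a n x) \<le> (1/2)^n * ((2 ^ n)\<^sup>2 * (a n x)\<^sup>2 + 1)"
          by (intro mult_left_mono) auto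
        then show ?thesis
          by (simp add: power_divide field_simps power2_eq_square)
      qed
      then show "norm (norm (f (Suc n) x - f n x)) \<le> 2 ^ n * (a n x)\<^sup>2 + (1/2) ^ n"
        by (simp add: a_def)
    qed
    then have "summable (\<lambda>n. f (Suc n) x - f n x)" by (rule summable_norm_cancel)
    then have "convergent (\<lambda>n. f n x - f 0 x)"
      by (simp only: summable_iff_convergent sum_lessThan_telescope[of "\<lambda>n. f n x"])
    then show "convergent (\<lambda>n. f n x)"
      by (simp only: convergent_diff_const_right_iff)
  qed
  define g where "g x = lim (\<lambda>n. f n x)" for x
  have [measurable]: "g \<in> borel_measurable borel" unfolding g_def by measurable
  \<comment> \<open>Fatou in \<open>n\<close> presupposes no integrability of \<open>g\<close>, so
    the same estimate first places \<open>g\<close> in the space and then bounds its distance from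
    \<open>f m\<close>.\<close>
  have fatou: "(\<integral>\<^sup>+x. ennreal ((cmod (g x - f m x))\<^sup>2) \<partial>lborel)
      \<le> liminf (\<lambda>n. ennreal ((norm (X n - X m))\<^sup>2))" for m
  proof -
    have "(\<integral>\<^sup>+x. ennreal ((cmod (g x - f m x))\<^sup>2) \<partial>lborel) =
        (\<integral>\<^sup>+x. liminf (\<lambda>n. ennreal ((cmod (f n x - f m x))\<^sup>2)) \<partial>lborel)"
    proof (rule nn_integral_cong_AE, use conv in eventually_elim)
      fix x assume "convergent (\<lambda>n. f n x)"
      then have "(\<lambda>n. f n x) \<longlonglongrightarrow> g x" by (simp add: g_def convergent_LIMSEQ_iff)
      then have "(\<lambda>n. ennreal ((cmod (f n x - f m x))\<^sup>2)) \<longlonglongrightarrow> ennreal ((cmod (g x - f m x))\<^sup>2)"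
        by (intro tendsto_intros)
      then show "ennreal ((cmod (g x - f m x))\<^sup>2) = liminf (\<lambda>n. ennreal ((cmod (f n x - f m x))\<^sup>2))"
        by (rule lim_imp_Liminf[OF sequentially_bot, symmetric])
    qed
    also have "\<dots> \<le> liminf (\<lambda>n. \<integral>\<^sup>+x. ennreal ((cmod (f n x - f m x))\<^sup>2) \<partial>lborel)"
      by (rule nn_integral_liminf) measurable
    also have "\<dots> = liminf (\<lambda>n. ennreal ((norm (X n - X m))\<^sup>2))"
      by (simp add: L2_ennnorm sq_integrable_diff L2_of_diff)
    finally show ?thesis .
  qed
  have small: "\<exists>M. \<forall>m\<ge>M. (\<integral>\<^sup>+x. ennreal ((cmod (g x - f m x))\<^sup>2) \<partial>lborel) \<le> ennreal (e\<^sup>2)" if e0: "0 < e" for e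
  proof -
    obtain M where M: "\<And>m n. m \<ge> M \<Longrightarrow> n \<ge> M \<Longrightarrow> norm (X m - X n) < e"
      using CauchyD[OF \<open>Cauchy X\<close> e0] by blast
    have "(\<integral>\<^sup>+x. ennreal ((cmod (g x - f m x))\<^sup>2) \<partial>lborel) \<le> ennreal (e\<^sup>2)" if "m \<ge> M" for m
    proof (rule order_trans[OF fatou])
      have "liminf (\<lambda>n. ennreal ((norm (X n - X m))\<^sup>2)) \<le> limsup (\<lambda>n. ennreal ((norm (X n - X m))\<^sup>2))"
        by (rule Liminf_le_Limsup) simp
      also have "\<dots> \<le> ennreal (e\<^sup>2)"
        by (rule Limsup_bounded, rule eventually_sequentiallyI[of M])
           (intro ennreal_leI power_mono less_imp_le[OF M] that norm_ge_zero)
      finally show "liminf (\<lambda>n. ennreal ((norm (X n - X m))\<^sup>2)) \<le> ennreal (e\<^sup>2)" .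
    qed
    then show ?thesis by blast
  qed
  obtain M where "(\<integral>\<^sup>+x. ennreal ((cmod (g x - f M x))\<^sup>2) \<partial>lborel) \<le> ennreal (1\<^sup>2)"
    using small[of 1] by auto
  then have "(\<integral>\<^sup>+x. ennreal ((cmod (g x - f M x))\<^sup>2) \<partial>lborel) < \<infinity>"
    by (rule le_less_trans) simp
  then have "sq_integrable (\<lambda>x. g x - f M x)"
    by (subst sq_integrable_iff_nn) auto
  then have g: "sq_integrable g"
    using sq_integrable_add[of "\<lambda>x. g x - f M x" "f M"] by simp
  have "X \<longlonglongrightarrow> L2_of g"
  proof (rule LIMSEQ_I)
    fix e :: real assume "0 < e"
    then obtain M where M: "\<And>m. m \<ge> M \<Longrightarrow> (\<integral>\<^sup>+x. ennreal ((cmod (g x - f m x))\<^sup>2) \<partial>lborel) \<le> ennreal ((e/2)\<^sup>2)"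
      using small[of "e/2"] by auto
    have "norm (X m - L2_of g) < e" if "m \<ge> M" for m
    proof -
      have "ennreal ((norm (L2_of g - X m))\<^sup>2) \<le> ennreal ((e/2)\<^sup>2)"
        using M[OF that] g by (simp add: L2_ennnorm sq_integrable_diff L2_of_diff)
      then have "(norm (L2_of g - X m))\<^sup>2 \<le> (e/2)\<^sup>2" by (simp add: ennreal_le_iff)
      then have "norm (L2_of g - X m) \<le> e/2" using \<open>0 < e\<close> by (simp add: abs_le_square_iff[symmetric])
      then show ?thesis using \<open>0 < e\<close> by (simp add: norm_minus_commute)
    qed
    then show "\<exists>no. \<forall>n\<ge>no. norm (X n - L2_of g) < e" by blast
  qed
  then show ?thesis by (rule convergentI)
qed

instance L2 :: banach
proof
  fix X :: "nat \<Rightarrow> L2" assume X: "Cauchy X"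
  have "\<exists>N. \<forall>m\<ge>N. \<forall>n\<ge>N. norm (X m - X n) < (1/2) ^ k" for k
    using CauchyD[OF X, of "(1/2)^k"] by simp
  then obtain N where N: "\<And>k m n. m \<ge> N k \<Longrightarrow> n \<ge> N k \<Longrightarrow> norm (X m - X n) < (1/2) ^ k"
    by metis
  \<comment> \<open>The summand \<open>k\<close> makes \<open>r\<close> strictly increasing, and the
    sum makes it dominate \<open>N\<close>. Consecutive terms are compared, so \<open>N k\<close>
    must also lie below \<open>r (Suc k)\<close>.\<close>
  define r where "r k = k + (\<Sum>i\<le>k. N i)" for k
  have r: "strict_mono r" by (rule strict_monoI_Suc) (simp add: r_def)
  have rN: "N k \<le> r k" for k
    using member_le_sum[of k "{..k}" N] by (simp add: r_def)
  have rN': "N k \<le> r (Suc k)" for k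
    using rN[of k] strict_mono_less[OF r, of k "Suc k"] by simp
  have "convergent (X \<circ> r)"
  proof (rule L2_fast_Cauchy_convergent)
    show "Cauchy (X \<circ> r)" by (rule Cauchy_subseq_Cauchy[OF X r])
    show "norm ((X \<circ> r) (Suc n) - (X \<circ> r) n) \<le> (1/2) ^ n" for n
      using N[OF rN' rN] by (simp add: less_imp_le)
  qed
  then obtain l where "(X \<circ> r) \<longlonglongrightarrow> l" by (auto simp: convergent_def)
  then show "convergent X"
    using Cauchy_converges_subseq[OF X r] by (auto simp: convergent_def)
qed

text \<open>Bridge between the difference quotients in \<open>generator\<close> and the
  differentiation rules for \<open>has_vector_derivative\<close>.\<close>

lemma has_vector_derivative_at_0:
  "(f has_vector_derivative d) (at (0::real)) \<longleftrightarrow> ((\<lambda>t. (f t - f 0) /\<^sub>R t) \<longlongrightarrow> d) (at 0)"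
proof -
  have "(f has_vector_derivative d) (at 0) \<longleftrightarrow> ((\<lambda>t. (f t - f 0 - t *\<^sub>R d) /\<^sub>R \<bar>t\<bar>) \<longlongrightarrow> 0) (at 0)"
    by (simp add: has_vector_derivative_def has_derivative_at_within bounded_linear_scaleR_left)
  also have "\<dots> \<longleftrightarrow> ((\<lambda>t. (f t - f 0) /\<^sub>R t - d) \<longlongrightarrow> 0) (at 0)"
  proof -
    have "norm ((f t - f 0 - t *\<^sub>R d) /\<^sub>R \<bar>t\<bar>) = norm ((f t - f 0) /\<^sub>R t - d)" if "t \<noteq> 0" for t
    proof -
      have "(f t - f 0) /\<^sub>R t - d = (f t - f 0 - t *\<^sub>R d) /\<^sub>R t"
        using that by (simp add: scaleR_diff_right)
      then show ?thesis by simp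
    qed
    then show ?thesis
      by (subst (1 2) tendsto_norm_zero_iff[symmetric]) (rule LIM_equal, blast)
  qed
  finally show ?thesis by (simp add: LIM_zero_iff)
qed

lemma L2_dominated_convergence:
  fixes h :: "nat \<Rightarrow> real \<Rightarrow> complex"
  assumes g: "sq_integrable g" and h [measurable]: "\<And>n. h n \<in> borel_measurable borel"
    and le: "\<And>n x. cmod (h n x) \<le> cmod (g x)"
    and lim: "\<And>x. (\<lambda>n. h n x) \<longlonglongrightarrow> 0"
  shows "(\<lambda>n. L2_of (h n)) \<longlonglongrightarrow> 0"
proof -
  have sq: "sq_integrable (h n)" for n by (rule sq_integrable_bound[OF g h le])
  have "(\<lambda>n. LINT x|lborel. (cmod (h n x))\<^sup>2) \<longlonglongrightarrow> (LINT x|(lborel::real measure). 0)"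
  proof (rule integral_dominated_convergence[where w="\<lambda>x. (cmod (g x))\<^sup>2"])
    show "integrable lborel (\<lambda>x. (cmod (g x))\<^sup>2)" using g by (simp add: sq_integrable_def)
    have "(\<lambda>n. (cmod (h n x))\<^sup>2) \<longlonglongrightarrow> (cmod 0)\<^sup>2" for x
      by (intro tendsto_intros lim)
    then show "AE x in lborel. (\<lambda>n. (cmod (h n x))\<^sup>2) \<longlonglongrightarrow> 0" by simp
  qed (auto intro!: power_mono le)
  then have "(\<lambda>n. (norm (L2_of (h n)))\<^sup>2) \<longlonglongrightarrow> 0"
    by (simp add: norm_L2_of sq)
  then have "(\<lambda>n. sqrt ((norm (L2_of (h n)))\<^sup>2)) \<longlonglongrightarrow> sqrt 0"
    by (intro tendsto_intros)
  then show ?thesis by (simp add: tendsto_norm_zero_iff)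
qed

section \<open>The unperturbed group\<close>

text \<open>This is exp(-it M_x), the group of the operator with coupling constant 0, in the sign
  convention of \<open>generator\<close>.\<close>

definition phase :: "real \<Rightarrow> L2 \<Rightarrow> L2" where
  "phase t v = L2_of (\<lambda>x. cis (- (t * x)) * rep_L2 v x)"

lemma borel_measurable_cis [measurable]:
  "f \<in> borel_measurable M \<Longrightarrow> (\<lambda>x. cis (f x)) \<in> borel_measurable M"
  by (rule borel_measurable_continuous_on[of cis]) (auto intro!: continuous_intros)

lemma sq_integrable_cis: "sq_integrable f \<Longrightarrow> sq_integrable (\<lambda>x. cis (t * x) * f x)"
proof (rule sq_integrable_bound[of f])
  assume "sq_integrable f"
  then have [measurable]: "f \<in> borel_measurable borel" by (rule sq_integrable_measurable)
  show "(\<lambda>x. cis (t * x) * f x) \<in> borel_measurable borel" by measurable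
qed (auto simp: norm_mult)

lemmas sq_integrable_cis' = sq_integrable_cis[of _ "- t" for t, simplified]

lemma phase_L2_of:
  assumes f: "sq_integrable f"
  shows "phase t (L2_of f) = L2_of (\<lambda>x. cis (- (t * x)) * f x)"
  unfolding phase_def
proof (rule L2_of_eqI)
  show "AE x in lborel. cis (- (t * x)) * rep_L2 (L2_of f) x = cis (- (t * x)) * f x"
    using rep_L2_of[OF f] by eventually_elim simp
qed (simp_all add: sq_integrable_cis' f)

lemma phase_add: "phase t (v + w) = phase t v + phase t w"
proof -
  have "phase t (L2_of (rep_L2 v) + L2_of (rep_L2 w)) = phase t (L2_of (rep_L2 v)) + phase t (L2_of (rep_L2 w))"
    by (simp add: L2_of_add[symmetric] phase_L2_of sq_integrable_add sq_integrable_cis'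
        distrib_left del: L2_of_rep)
  then show ?thesis by simp
qed

lemma phase_cscale: "phase t (cscale c v) = cscale c (phase t v)"
proof -
  have "phase t (cscale c (L2_of (rep_L2 v))) = cscale c (phase t (L2_of (rep_L2 v)))"
    by (simp add: L2_of_cscale[symmetric] phase_L2_of sq_integrable_cmult sq_integrable_cis'
        mult.left_commute del: L2_of_rep)
  then show ?thesis by simp
qed

lemma phase_scaleR: "phase t (r *\<^sub>R v) = r *\<^sub>R phase t v"
  by (simp add: scaleR_cscale phase_cscale)

lemma phase_diff: "phase t (v - w) = phase t v - phase t w"
  using phase_add[of t v "- w"] phase_cscale[of t "-1" w] by (simp add: cscale_minus_1)

lemma phase_phase: "phase s (phase t v) = phase (s + t) v"
proof -
  have "phase s (phase t (L2_of (rep_L2 v))) = phase (s + t) (L2_of (rep_L2 v))"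
    by (simp add: phase_L2_of sq_integrable_cis' cis_mult mult.assoc[symmetric] ring_distribs
        del: L2_of_rep)
  then show ?thesis by simp
qed

lemma phase_0 [simp]: "phase 0 v = v"
  by (simp add: phase_def)

lemma cinner_phase: "cinner (phase t v) (phase t w) = cinner v w"
proof -
  have "cis a * b * cnj (cis a * c) = b * cnj c" for a b c
    using complex_norm_square[of "cis a"] by simp
  then have "cinner (phase t (L2_of (rep_L2 v))) (phase t (L2_of (rep_L2 w))) = cinner (L2_of (rep_L2 v)) (L2_of (rep_L2 w))"
    by (simp only: phase_L2_of sq_integrable_cis' cinner_L2_of sq_integrable_rep)
  then show ?thesis by simp
qed

lemma cinner_phase_left: "cinner (phase t v) w = cinner v (phase (- t) w)"
  using cinner_phase[of "- t" "phase t v" w] by (simp add: phase_phase)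

lemma norm_phase [simp]: "norm (phase t v) = norm v"
proof -
  have "complex_of_real ((norm (phase t v))\<^sup>2) = of_real ((norm v)\<^sup>2)"
    by (simp only: cinner_self[symmetric] cinner_phase)
  then show ?thesis by (simp only: of_real_eq_iff power2_eq_iff_nonneg norm_ge_zero)
qed

lemma isCont_phase: "isCont (\<lambda>t. phase t v) t"
proof -
  define f where "f = rep_L2 v"
  have f: "sq_integrable f" "v = L2_of f" by (simp_all add: f_def)
  have [measurable]: "f \<in> borel_measurable borel" by (rule sq_integrable_measurable[OF f(1)])
  show ?thesis
  proof (rule continuous_at_sequentiallyI)
    fix s :: "nat \<Rightarrow> real" assume s: "s \<longlonglongrightarrow> t"
    have "(\<lambda>n. L2_of (\<lambda>x. (cis (- (s n * x)) - cis (- (t * x))) * f x)) \<longlonglongrightarrow> 0"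
    proof (rule L2_dominated_convergence)
      show "sq_integrable (\<lambda>x. 2 * f x)" by (rule sq_integrable_cmult[OF f(1)])
      show "cmod ((cis (- (s n * x)) - cis (- (t * x))) * f x) \<le> cmod (2 * f x)" for n x
        using norm_triangle_ineq4[of "cis (- (s n * x))" "cis (- (t * x))"]
        by (auto simp: norm_mult intro!: mult_right_mono)
      fix x
      have "(\<lambda>n. (cis (- (s n * x)) - cis (- (t * x))) * f x) \<longlonglongrightarrow> (cis (- (t * x)) - cis (- (t * x))) * f x"
        by (intro tendsto_intros s)
      then show "(\<lambda>n. (cis (- (s n * x)) - cis (- (t * x))) * f x) \<longlonglongrightarrow> 0" by simp
    qed measurable
    then have "(\<lambda>n. phase (s n) v - phase t v) \<longlonglongrightarrow> 0"
      by (simp add: f(2) phase_L2_of f(1) left_diff_distrib L2_of_diff sq_integrable_cis')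
    then show "(\<lambda>n. phase (s n) v) \<longlonglongrightarrow> phase t v"
      by (simp only: LIM_zero_iff)
  qed
qed

text \<open>Joint continuity in time and vector: \<open>phase\<close> is isometric, so an error in
  the vector is not amplified, and only strong continuity at the fixed vector \<open>v\<close> is
  left.\<close>

lemma tendsto_phase:
  assumes "(t \<longlongrightarrow> s) F" "(g \<longlongrightarrow> v) F"
  shows "((\<lambda>y. phase (t y) (g y)) \<longlongrightarrow> phase s v) F"
proof -
  have "((\<lambda>y. norm (g y - v) + norm (phase (t y) v - phase s v)) \<longlongrightarrow> norm (v - v) + norm (phase s v - phase s v)) F"
    by (intro tendsto_intros assms isCont_tendsto_compose[OF isCont_phase])
  then have "((\<lambda>y. norm (g y - v) + norm (phase (t y) v - phase s v)) \<longlongrightarrow> 0) F" by simp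
  then have "((\<lambda>y. phase (t y) (g y) - phase s v) \<longlongrightarrow> 0) F"
  proof (rule Lim_null_comparison[rotated], intro always_eventually allI)
    fix y
    have "phase (t y) (g y) - phase s v = phase (t y) (g y - v) + (phase (t y) v - phase s v)"
      by (simp add: phase_diff)
    then show "norm (phase (t y) (g y) - phase s v) \<le> norm (g y - v) + norm (phase (t y) v - phase s v)"
      using norm_triangle_ineq[of "phase (t y) (g y - v)" "phase (t y) v - phase s v"] by (simp only: norm_phase)
  qed
  then show ?thesis by (simp add: LIM_zero_iff)
qed

section \<open>The generator of the free group is the multiplication operator\<close>

lemma mult_x_SomeD:
  assumes "mult_x v = Some w"
  shows "sq_integrable (\<lambda>x. of_real x * rep_L2 v x)" "w = L2_of (\<lambda>x. of_real x * rep_L2 v x)"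
  using assms by (auto simp: mult_x_def Let_def split: if_splits)

text \<open>\<open>mult_x\<close> inspects the representative chosen by \<open>rep_L2\<close>;
  equality almost everywhere carries both membership in the domain and the value over to any other
  representative.\<close>

lemma mult_x_L2_of:
  assumes f: "sq_integrable f" and xf: "sq_integrable (\<lambda>x. of_real x * f x)"
  shows "mult_x (L2_of f) = Some (L2_of (\<lambda>x. of_real x * f x))"
proof -
  have ae: "AE x in lborel. of_real x * rep_L2 (L2_of f) x = of_real x * f x"
    using rep_L2_of[OF f] by eventually_elim simp
  have [measurable]: "rep_L2 (L2_of f) \<in> borel_measurable borel" by (simp add: sq_integrable_measurable)
  have "(\<integral>\<^sup>+x. ennreal ((cmod (of_real x * rep_L2 (L2_of f) x))\<^sup>2) \<partial>lborel) = (\<integral>\<^sup>+x. ennreal ((cmod (of_real x * f x))\<^sup>2) \<partial>lborel)"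
    by (rule nn_integral_cong_AE, use ae in eventually_elim) (simp only:)
  also have "\<dots> < \<infinity>" using xf by (subst sq_integrable_iff_nn[symmetric]) (auto simp: sq_integrable_def)
  finally have "sq_integrable (\<lambda>x. of_real x * rep_L2 (L2_of f) x)"
    by (subst sq_integrable_iff_nn) auto
  then show ?thesis
    unfolding mult_x_def Let_def using L2_of_eqI[OF _ xf ae] by simp
qed

lemma cmod_cis_minus_1_le: "cmod (cis a - 1) \<le> \<bar>a\<bar>"
  using dist_exp_i_1[of a] abs_sin_x_le_abs_x[of "a/2"] by (simp add: cis_conv_exp)

lemma cis_difference_quotient:
  assumes s: "s \<longlonglongrightarrow> 0" "\<And>n. s n \<noteq> 0"
  shows "(\<lambda>n. of_real (inverse (s n)) * (cis (- (s n * x)) * c - c)) \<longlonglongrightarrow> - \<i> * (of_real x * c)"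
proof -
  have "((\<lambda>t. cis (- (t * x)) * c) has_vector_derivative - \<i> * (of_real x * c)) (at 0)"
    by (auto intro!: derivative_eq_intros simp: has_vector_derivative_def scaleR_conv_of_real)
  then have "((\<lambda>t. (cis (- (t * x)) * c - c) /\<^sub>R t) \<longlongrightarrow> - \<i> * (of_real x * c)) (at 0)"
    by (simp only: has_vector_derivative_at_0) simp
  then show ?thesis
    using s unfolding tendsto_at_iff_sequentially by (auto simp: o_def scaleR_conv_of_real)
qed

text \<open>Since |cis a - 1| <= |a|, the difference quotient is pointwise at most |x f(x)|, as is
  its limit. Hence twice this function dominates the error, and it is square-integrable because
  \<open>v\<close> lies in the domain.\<close>

lemma phase_has_derivative_mult_x:
  assumes "mult_x v = Some w"
  shows "((\<lambda>t. (phase t v - v) /\<^sub>R t) \<longlongrightarrow> cscale (- \<i>) w) (at 0)"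
proof -
  define f where "f = rep_L2 v"
  have f: "sq_integrable f" "v = L2_of f" by (simp_all add: f_def)
  have [measurable]: "f \<in> borel_measurable borel" by (rule sq_integrable_measurable[OF f(1)])
  have xf: "sq_integrable (\<lambda>x. of_real x * f x)" and w: "w = L2_of (\<lambda>x. of_real x * f x)"
    using mult_x_SomeD[OF assms] by (auto simp: f_def)
  show ?thesis
    unfolding tendsto_at_iff_sequentially
  proof (intro allI impI)
    fix s :: "nat \<Rightarrow> real" assume "\<forall>i. s i \<in> UNIV - {0}" and s: "s \<longlonglongrightarrow> 0"
    then have s0: "s n \<noteq> 0" for n by auto
    have "(\<lambda>n. L2_of (\<lambda>x. of_real (inverse (s n)) * (cis (- (s n * x)) * f x - f x) - - \<i> * (of_real x * f x))) \<longlonglongrightarrow> 0"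
    proof (rule L2_dominated_convergence)
      show "sq_integrable (\<lambda>x. 2 * (of_real x * f x))" by (rule sq_integrable_cmult[OF xf])
      show "cmod (of_real (inverse (s n)) * (cis (- (s n * x)) * f x - f x) - - \<i> * (of_real x * f x))
          \<le> cmod (2 * (of_real x * f x))" for n x
      proof -
        have "cmod (of_real (inverse (s n)) * (cis (- (s n * x)) * f x - f x) - - \<i> * (of_real x * f x))
           \<le> cmod (of_real (inverse (s n)) * ((cis (- (s n * x)) - 1) * f x)) + cmod (\<i> * (of_real x * f x))"
          by (rule order_trans[OF _ norm_triangle_ineq]) (simp add: algebra_simps)
        also have "cmod (of_real (inverse (s n)) * ((cis (- (s n * x)) - 1) * f x)) \<le> inverse \<bar>s n\<bar> * (\<bar>s n * x\<bar> * cmod (f x))"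
          unfolding norm_mult using cmod_cis_minus_1_le[of "- (s n * x)"]
          by (intro mult_mono) (auto simp: norm_inverse)
        also have "\<dots> = \<bar>x\<bar> * cmod (f x)" using s0[of n] by (simp add: abs_mult)
        finally show ?thesis by (simp add: norm_mult)
      qed
      fix x
      show "(\<lambda>n. of_real (inverse (s n)) * (cis (- (s n * x)) * f x - f x) - - \<i> * (of_real x * f x)) \<longlonglongrightarrow> 0"
        by (rule iffD2[OF LIM_zero_iff], rule cis_difference_quotient[OF s s0])
    qed measurable
    moreover have "L2_of (\<lambda>x. of_real (inverse (s n)) * (cis (- (s n * x)) * f x - f x) - - \<i> * (of_real x * f x))
        = (phase (s n) v - v) /\<^sub>R s n - cscale (- \<i>) w" for n
      unfolding f(2) w phase_L2_of[OF f(1)] scaleR_cscale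
      by (simp only: L2_of_diff L2_of_cscale sq_integrable_diff sq_integrable_cis' sq_integrable_cmult xf f(1))
    ultimately have "(\<lambda>n. (phase (s n) v - v) /\<^sub>R s n - cscale (- \<i>) w) \<longlonglongrightarrow> 0"
      by simp
    then show "((\<lambda>t. (phase t v - v) /\<^sub>R t) \<circ> s) \<longlonglongrightarrow> cscale (- \<i>) w"
      by (simp only: LIM_zero_iff o_def)
  qed
qed

text \<open>By Fatou's lemma along \<open>t = 1/n\<close>.\<close>

lemma phase_differentiable_mult_x:
  assumes "((\<lambda>t. (phase t v - v) /\<^sub>R t) \<longlongrightarrow> w) (at 0)"
  shows "mult_x v \<noteq> None"
proof -
  define f where "f = rep_L2 v"
  have f: "sq_integrable f" "v = L2_of f" by (simp_all add: f_def)
  have [measurable]: "f \<in> borel_measurable borel" by (rule sq_integrable_measurable[OF f(1)])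
  define s where "s n = 1 / real (Suc n)" for n
  have s: "s \<longlonglongrightarrow> 0" unfolding s_def by (rule LIMSEQ_inverse_real_of_nat[unfolded inverse_eq_divide])
  have s0: "s n \<noteq> 0" for n by (simp add: s_def)
  define q where "q n x = of_real (inverse (s n)) * (cis (- (s n * x)) * f x - f x)" for n x
  have [measurable]: "q n \<in> borel_measurable borel" for n unfolding q_def by measurable
  have q: "sq_integrable (q n)" "L2_of (q n) = (phase (s n) v - v) /\<^sub>R s n" for n
    unfolding q_def
    by (simp_all add: f(2) phase_L2_of f(1) L2_of_diff sq_integrable_diff sq_integrable_cis'
          sq_integrable_cmult L2_of_cscale scaleR_cscale)
  have "(\<lambda>n. (phase (s n) v - v) /\<^sub>R s n) \<longlonglongrightarrow> w"
    using assms s s0 unfolding tendsto_at_iff_sequentially by (auto simp: o_def)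
  then have "(\<lambda>n. ennreal ((norm (L2_of (q n)))\<^sup>2)) \<longlonglongrightarrow> ennreal ((norm w)\<^sup>2)"
    unfolding q by (intro tendsto_intros)
  then have lim: "liminf (\<lambda>n. ennreal ((norm (L2_of (q n)))\<^sup>2)) = ennreal ((norm w)\<^sup>2)"
    by (intro lim_imp_Liminf) auto
  have "(\<integral>\<^sup>+x. ennreal ((cmod (of_real x * f x))\<^sup>2) \<partial>lborel) = (\<integral>\<^sup>+x. liminf (\<lambda>n. ennreal ((cmod (q n x))\<^sup>2)) \<partial>lborel)"
  proof (rule nn_integral_cong)
    fix x
    have "(\<lambda>n. q n x) \<longlonglongrightarrow> - \<i> * (of_real x * f x)"
      unfolding q_def by (rule cis_difference_quotient[OF s s0])
    then have "(\<lambda>n. ennreal ((cmod (q n x))\<^sup>2)) \<longlonglongrightarrow> ennreal ((cmod (- \<i> * (of_real x * f x)))\<^sup>2)"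
      by (intro tendsto_intros)
    from lim_imp_Liminf[OF sequentially_bot this]
    show "ennreal ((cmod (of_real x * f x))\<^sup>2) = liminf (\<lambda>n. ennreal ((cmod (q n x))\<^sup>2))"
      by (simp add: norm_mult)
  qed
  also have "\<dots> \<le> liminf (\<lambda>n. \<integral>\<^sup>+x. ennreal ((cmod (q n x))\<^sup>2) \<partial>lborel)"
    by (rule nn_integral_liminf) measurable
  also have "\<dots> < \<infinity>" using lim by (simp add: L2_ennnorm q(1))
  finally have "sq_integrable (\<lambda>x. of_real x * f x)"
    by (subst sq_integrable_iff_nn) auto
  then show ?thesis using mult_x_L2_of[OF f(1)] by (simp add: f(2))
qed

section \<open>Linear evolution equations with bounded coefficients\<close>

definition primitive :: "(real \<Rightarrow> 'a::banach) \<Rightarrow> real \<Rightarrow> 'a" where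
  "primitive p t = (if 0 \<le> t then integral {0..t} p else - integral {t..0} p)"

lemma primitive_0 [simp]: "primitive p 0 = 0"
  by (simp add: primitive_def)

lemma primitive_has_vector_derivative:
  assumes p: "continuous_on UNIV p"
  shows "(primitive p has_vector_derivative p t) (at t)"
proof -
  \<comment> \<open>Both 0 and \<open>t\<close> lie inside (-n, n). Near \<open>t\<close> the
    primitive is therefore the integral based at -n minus a constant, and the case distinction at 0
    does not disturb differentiability.\<close>
  define n where "n = \<bar>t\<bar> + 1"
  have int: "p integrable_on {a..b}" for a b
    by (intro integrable_continuous_interval continuous_on_subset[OF p]) auto
  have "((\<lambda>s. integral {-n..s} p) has_vector_derivative p t) (at t within {-n..n})"
    by (rule integral_has_vector_derivative) (auto intro: continuous_on_subset[OF p] simp: n_def)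
  then have "((\<lambda>s. integral {-n..s} p - integral {-n..0} p) has_vector_derivative p t) (at t within {-n..n})"
    by (auto intro!: derivative_eq_intros)
  moreover have "at t within {-n..n} = at t"
    by (rule at_within_interior) (auto simp: n_def)
  ultimately have "((\<lambda>s. integral {-n..s} p - integral {-n..0} p) has_vector_derivative p t) (at t)"
    by simp
  then show ?thesis
  proof (rule has_vector_derivative_transform_within_open[where S="{-n<..<n}"])
    fix s assume s: "s \<in> {-n<..<n}"
    show "integral {-n..s} p - integral {-n..0} p = primitive p s"
    proof (cases "0 \<le> s")
      case True
      then show ?thesis
        using Henstock_Kurzweil_Integration.integral_combine[of "-n" 0 s p] int s
        by (auto simp: primitive_def n_def algebra_simps)
    next
      case False
      then show ?thesis
        using Henstock_Kurzweil_Integration.integral_combine[of "-n" s 0 p] int s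
        by (auto simp: primitive_def n_def algebra_simps)
    qed
  qed (auto simp: n_def)
qed

text \<open>Integration reproduces the weight exp(c |t|) with a gain of 1/c. This gain is what turns
  the Picard map into a contraction on the whole line.\<close>

lemma norm_primitive_le:
  assumes p: "continuous_on UNIV p" and le: "\<And>s. norm (p s) \<le> K * exp (c * \<bar>s\<bar>)" and c: "0 < c"
  shows "norm (primitive p t) \<le> K / c * exp (c * \<bar>t\<bar>)"
proof -
  have int: "p integrable_on {a..b}" for a b
    by (intro integrable_continuous_interval continuous_on_subset[OF p]) auto
  have K: "0 \<le> K" using order_trans[OF norm_ge_zero le[of 0]] by simp
  show ?thesis
  proof (cases "0 \<le> t")
    case True
    have "((\<lambda>s. K * exp (c * s)) has_integral K / c * exp (c * t) - K / c * exp (c * 0)) {0..t}"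
      using True c by (intro fundamental_theorem_of_calculus)
        (auto intro!: derivative_eq_intros simp: has_real_derivative_iff_has_vector_derivative[symmetric])
    then have I: "(\<lambda>s. K * exp (c * s)) integrable_on {0..t}"
      "integral {0..t} (\<lambda>s. K * exp (c * s)) = K / c * exp (c * t) - K / c"
      by (auto simp: integrable_on_def dest: integral_unique simp del: integral_mult_right integral_mult_left)
    have "norm (integral {0..t} p) \<le> integral {0..t} (\<lambda>s. K * exp (c * s))"
      using le by (intro integral_norm_bound_integral int I) (metis abs_of_nonneg atLeastAtMost_iff)
    also have "\<dots> \<le> K / c * exp (c * t)" using K c by (simp add: I del: integral_mult_right)
    finally show ?thesis using True by (simp add: primitive_def)
  next
    case False
    have "((\<lambda>s. K * exp (- (c * s))) has_integral - K / c * exp (- (c * 0)) - - K / c * exp (- (c * t))) {t..0}"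
      using False c by (intro fundamental_theorem_of_calculus)
        (auto intro!: derivative_eq_intros simp: has_real_derivative_iff_has_vector_derivative[symmetric])
    then have I: "(\<lambda>s. K * exp (- (c * s))) integrable_on {t..0}"
      "integral {t..0} (\<lambda>s. K * exp (- (c * s))) = K / c * exp (- (c * t)) - K / c"
      by (auto simp: integrable_on_def dest: integral_unique simp del: integral_mult_right integral_mult_left)
    have "norm (p s) \<le> K * exp (- (c * s))" if "s \<le> 0" for s using le[of s] that by simp
    then have "norm (integral {t..0} p) \<le> integral {t..0} (\<lambda>s. K * exp (- (c * s)))"
      by (intro integral_norm_bound_integral int I) auto
    also have "\<dots> \<le> K / c * exp (- (c * t))" using K c by (simp add: I del: integral_mult_right)
    finally show ?thesis using False by (simp add: primitive_def)
  qed
qed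

lemma primitive_zero: "primitive (\<lambda>s. 0) t = 0"
  by (simp add: primitive_def)

lemma primitive_diff:
  assumes p: "continuous_on UNIV p" and q: "continuous_on UNIV q"
  shows "primitive p t - primitive q t = primitive (\<lambda>s. p s - q s) t"
proof -
  have "p integrable_on {a..b}" "q integrable_on {a..b}" for a b
    by (auto intro!: integrable_continuous_interval intro: continuous_on_subset[OF p] continuous_on_subset[OF q])
  then show ?thesis by (simp add: primitive_def integral_diff)
qed

text \<open>Picard iteration contracts on all of \<open>\<real>\<close> at once for the weighted supremum norm
  \<open>sup\<^sub>t e\<^sup>-\<^sup>c\<^sup>|\<^sup>t\<^sup>| \<parallel>W t\<parallel>\<close>.\<close>

lemma Lipschitz_ode_exists:
  fixes A :: "real \<Rightarrow> 'a::banach \<Rightarrow> 'a"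
  assumes cont: "\<And>W. continuous_on UNIV W \<Longrightarrow> continuous_on UNIV (\<lambda>t. A t (W t))"
    and zero: "\<And>t. A t 0 = 0"
    and Lip: "\<And>t x y. norm (A t x - A t y) \<le> L * norm (x - y)"
  shows "\<exists>W. W 0 = v \<and> (\<forall>t. (W has_vector_derivative A t (W t)) (at t))"
proof -
  \<comment> \<open>The factor 2 yields the contraction constant 1/2; the summand 1 keeps
    \<open>c\<close> positive when \<open>L\<close> is 0.\<close>
  define c where "c = 2 * \<bar>L\<bar> + 1"
  have c: "0 < c" "\<bar>L\<bar> / c \<le> 1/2" by (auto simp: c_def field_simps)
  have Lip': "norm (A t x - A t y) \<le> \<bar>L\<bar> * norm (x - y)" for t x y
    by (rule order_trans[OF Lip]) (auto intro: mult_right_mono)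
  define w where "w t = exp (c * \<bar>t\<bar>)" for t
  have w: "continuous_on UNIV w" unfolding w_def by (intro continuous_intros)
  have w1: "1 \<le> w t" "0 < w t" "w t \<noteq> 0" for t using c by (auto simp: w_def)
  \<comment> \<open>\<open>b\<close> stands for the solution divided by its weight, so the ordinary
    sup norm of bounded continuous functions is the weighted norm of the solution.\<close>
  define p where "p b s = A s (w s *\<^sub>R apply_bcontfun b s)" for b s
  have b_cont: "continuous_on UNIV (apply_bcontfun b)" for b :: "real \<Rightarrow>\<^sub>C 'a"
    using apply_bcontfun[of b] by (simp add: bcontfun_def)
  have p_cont: "continuous_on UNIV (p b)" for b
    unfolding p_def by (intro cont continuous_intros w b_cont)
  have p_diff: "norm (p b s - p b' s) \<le> \<bar>L\<bar> * dist b b' * exp (c * \<bar>s\<bar>)" for b b' s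
  proof -
    have "norm (p b s - p b' s) \<le> \<bar>L\<bar> * norm (w s *\<^sub>R apply_bcontfun b s - w s *\<^sub>R apply_bcontfun b' s)"
      unfolding p_def by (rule Lip')
    also have "norm (w s *\<^sub>R apply_bcontfun b s - w s *\<^sub>R apply_bcontfun b' s) = w s * dist (apply_bcontfun b s) (apply_bcontfun b' s)"
      using w1[of s] by (simp add: scaleR_diff_right[symmetric] dist_norm)
    also have "\<bar>L\<bar> * (w s * dist (apply_bcontfun b s) (apply_bcontfun b' s)) \<le> \<bar>L\<bar> * (w s * dist b b')"
      using w1[of s] by (intro mult_left_mono dist_bounded) auto
    finally show ?thesis by (simp add: w_def mult_ac)
  qed
  \<comment> \<open>Comparison with \<open>b' = 0\<close> turns the Lipschitz estimate into a bound
    for \<open>primitive (p b)\<close> itself. This is where \<open>A t 0 = 0\<close> enters, and it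
    is why \<open>f b\<close> is bounded.\<close>
  have p0: "p 0 = (\<lambda>s. 0)" by (simp add: p_def zero fun_eq_iff)
  define f where "f b t = (v + primitive (p b) t) /\<^sub>R w t" for b t
  have prim_le: "norm (primitive (p b) t - primitive (p b') t) \<le> (1/2 * dist b b') * w t" for b b' t
  proof -
    have "norm (primitive (p b) t - primitive (p b') t) \<le> \<bar>L\<bar> * dist b b' / c * exp (c * \<bar>t\<bar>)"
      unfolding primitive_diff[OF p_cont p_cont]
      by (rule norm_primitive_le[OF _ p_diff c(1)]) (intro continuous_intros p_cont)
    also have "\<dots> = (\<bar>L\<bar> / c) * (dist b b' * w t)" by (simp add: w_def)
    also have "\<dots> \<le> 1/2 * (dist b b' * w t)"
      using c w1(2)[of t] by (intro mult_right_mono) auto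
    finally show ?thesis by simp
  qed
  have f_bcont: "f b \<in> bcontfun" for b
  proof (rule bcontfun_normI)
    have "continuous_on UNIV (primitive (p b))"
      using primitive_has_vector_derivative[OF p_cont, of b]
      by (intro continuous_at_imp_continuous_on ballI has_vector_derivative_continuous)
    then show "continuous_on UNIV (f b)"
      unfolding f_def using w1 by (intro continuous_intros w) auto
    fix t
    have "norm (f b t) = norm (v + primitive (p b) t) / w t"
      using w1[of t] by (simp add: f_def divide_inverse mult.commute)
    also have "\<dots> \<le> (norm v + 1/2 * norm b * w t) / w t"
      using norm_triangle_ineq[of v "primitive (p b) t"] prim_le[of b t 0] w1[of t]
      by (intro divide_right_mono) (auto simp: p0 primitive_zero dist_norm)
    also have "\<dots> \<le> norm v + 1/2 * norm b"
      using w1[of t] mult_left_mono[OF w1(1)[of t], of "norm v"] by (simp add: field_simps)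
    finally show "norm (f b t) \<le> norm v + 1/2 * norm b" .
  qed
  define T where "T b = Bcontfun (f b)" for b
  have T: "apply_bcontfun (T b) = f b" for b
    unfolding T_def by (rule Bcontfun_inverse[OF f_bcont])
  have "\<exists>!b. T b = b"
  proof (rule banach_fix_type[where c="1/2"], simp, simp, intro allI)
    fix b b'
    show "dist (T b) (T b') \<le> 1/2 * dist b b'"
    proof (rule dist_bound)
      fix t
      have "dist (f b t) (f b' t) = norm (primitive (p b) t - primitive (p b') t) / w t"
        using w1[of t] by (simp add: f_def dist_norm scaleR_diff_right[symmetric] divide_inverse mult.commute)
      also have "\<dots> \<le> 1/2 * dist b b'"
        using prim_le[of b t b'] w1[of t] by (simp add: field_simps)
      finally show "dist (apply_bcontfun (T b) t) (apply_bcontfun (T b') t) \<le> 1/2 * dist b b'" by (simp add: T)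
    qed
  qed
  then obtain b where "T b = b" by auto
  then have b: "apply_bcontfun b t = f b t" for t by (metis T)
  define W where "W t = v + primitive (p b) t" for t
  have "w t *\<^sub>R apply_bcontfun b t = W t" for t
    unfolding b using w1[of t] by (simp add: f_def W_def)
  then have pW: "p b t = A t (W t)" for t by (simp add: p_def)
  have "(W has_vector_derivative A t (W t)) (at t)" for t
    unfolding W_def[abs_def] using primitive_has_vector_derivative[OF p_cont, of b t]
    by (auto intro!: derivative_eq_intros simp: pW W_def)
  then show ?thesis by (intro exI[of _ W]) (simp add: W_def)
qed

section \<open>The group generated by the perturbed operator\<close>

text \<open>In the interaction picture \<open>W t = e\<^sup>i\<^sup>t\<^sup>x e\<^sup>-\<^sup>i\<^sup>t\<^sup>H v\<close> the coefficients are bounded.\<close>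

definition interaction_sol :: "L2 \<Rightarrow> real \<Rightarrow> (real \<Rightarrow> L2) \<Rightarrow> bool" where
  "interaction_sol u a W \<longleftrightarrow> (\<forall>t. (W has_vector_derivative
     cscale (- \<i> * a * cinner (W t) (phase (- t) u)) (phase (- t) u)) (at t))"

lemma continuous_on_phase:
  assumes "continuous_on S t" "continuous_on S g"
  shows "continuous_on S (\<lambda>y. phase (t y) (g y))"
  using assms unfolding continuous_on_def by (auto intro: tendsto_phase)

lemma interaction_sol_exists: "\<exists>W. W 0 = v \<and> interaction_sol u a W"
  unfolding interaction_sol_def
proof (rule Lipschitz_ode_exists[where L="\<bar>a\<bar> * norm u * norm u"])
  fix W :: "real \<Rightarrow> L2" assume "continuous_on UNIV W"
  then show "continuous_on UNIV (\<lambda>t. cscale (- \<i> * a * cinner (W t) (phase (- t) u)) (phase (- t) u))"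
    by (intro cscale.continuous_on cinner.continuous_on continuous_on_phase continuous_intros)
next
  fix t x y
  have "cscale (- \<i> * a * cinner x (phase (- t) u)) (phase (- t) u) - cscale (- \<i> * a * cinner y (phase (- t) u)) (phase (- t) u)
      = cscale (- \<i> * a * cinner (x - y) (phase (- t) u)) (phase (- t) u)"
    by (simp add: cinner.diff_left cscale.diff_left[symmetric] algebra_simps)
  then show "norm (cscale (- \<i> * a * cinner x (phase (- t) u)) (phase (- t) u) - cscale (- \<i> * a * cinner y (phase (- t) u)) (phase (- t) u))
      \<le> \<bar>a\<bar> * norm u * norm u * norm (x - y)"
    using mult_left_mono[OF cinner_Cauchy_Schwarz[of "x - y" "phase (- t) u"], of "\<bar>a\<bar> * norm u"]
    by (simp add: norm_cscale norm_mult mult_ac)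
qed (simp add: cinner.zero_left cscale.zero_left)

text \<open>As \<open>a\<close> is real, the rank-one coefficient is skew-adjoint: with e =
  \<open>phase (- t) u\<close>, the product rule gives the terms i a <V,e><e,W> and -i a <V,e><e,W>.
  Isometry of the evolution follows, and so does uniqueness, when the lemma is applied to a
  difference of solutions.\<close>

lemma cinner_interaction_sol:
  assumes "interaction_sol u a V" "interaction_sol u a W"
  shows "cinner (V t) (W t) = cinner (V 0) (W 0)"
proof -
  have "((\<lambda>t. cinner (V t) (W t)) has_vector_derivative 0) (at t within UNIV)" for t
  proof -
    have "((\<lambda>t. cinner (V t) (W t)) has_vector_derivative
        cinner (V t) (cscale (- \<i> * a * cinner (W t) (phase (- t) u)) (phase (- t) u)) +
        cinner (cscale (- \<i> * a * cinner (V t) (phase (- t) u)) (phase (- t) u)) (W t)) (at t)"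
      using assms unfolding interaction_sol_def by (intro cinner.has_vector_derivative) auto
    then show ?thesis
      by (simp add: cinner_cscale_left cinner_cscale_right cinner_commute[of "phase (- t) u" "W t"])
  qed
  then obtain c where "\<And>t. t \<in> UNIV \<Longrightarrow> cinner (V t) (W t) = c"
    by (rule has_vector_derivative_zero_constant[OF convex_UNIV]) auto
  then show ?thesis by simp
qed

lemma interaction_sol_add:
  assumes "interaction_sol u a V" "interaction_sol u a W"
  shows "interaction_sol u a (\<lambda>t. V t + W t)"
  using assms unfolding interaction_sol_def
  by (auto intro!: derivative_eq_intros simp: cinner_add_left cscale_add_left[symmetric] algebra_simps)

lemma interaction_sol_cscale:
  assumes "interaction_sol u a V"
  shows "interaction_sol u a (\<lambda>t. cscale c (V t))"
  unfolding interaction_sol_def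
proof
  fix t
  have "(V has_vector_derivative cscale (- \<i> * a * cinner (V t) (phase (- t) u)) (phase (- t) u)) (at t)"
    using assms unfolding interaction_sol_def by blast
  from bounded_linear.has_vector_derivative[OF cscale.bounded_linear_right[of c] this]
  show "((\<lambda>t. cscale c (V t)) has_vector_derivative
      cscale (- \<i> * a * cinner (cscale c (V t)) (phase (- t) u)) (phase (- t) u)) (at t)"
    by (simp add: cinner_cscale_left mult_ac)
qed

lemma interaction_sol_unique:
  assumes V: "interaction_sol u a V" and W: "interaction_sol u a W" and "V 0 = W 0"
  shows "V t = W t"
proof -
  have "interaction_sol u a (\<lambda>t. V t + cscale (-1) (W t))"
    by (intro interaction_sol_add interaction_sol_cscale V W)
  from cinner_interaction_sol[OF this this, of t] show ?thesis
    using \<open>V 0 = W 0\<close> by (simp add: cscale_minus_1 cinner_self)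
qed

lemma bounded_linear_phase: "bounded_linear (phase t)"
  by (rule bounded_linear_intro[where K=1]) (simp_all add: phase_add phase_scaleR)

text \<open>The equation is not autonomous: a shift of time by \<open>s\<close> rotates the
  coefficient vector, and \<open>phase s\<close> rotates it back. Together with uniqueness this is
  the group law.\<close>

lemma interaction_sol_shift:
  assumes "interaction_sol u a W"
  shows "interaction_sol u a (\<lambda>t. phase s (W (s + t)))"
  unfolding interaction_sol_def
proof
  fix t
  have "(W has_vector_derivative
     cscale (- \<i> * a * cinner (W (s + t)) (phase (- (s + t)) u)) (phase (- (s + t)) u)) (at (s + t))"
    using assms unfolding interaction_sol_def by blast
  then have "((\<lambda>t. W (s + t)) has_vector_derivative
     cscale (- \<i> * a * cinner (W (s + t)) (phase (- (s + t)) u)) (phase (- (s + t)) u)) (at t)"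
    using vector_diff_chain_at[of "\<lambda>t. s + t" 1 t W, unfolded o_def scaleR_one]
      has_vector_derivative_add[OF has_vector_derivative_const[of s] has_vector_derivative_id[of "at t"]]
    by simp
  from bounded_linear.has_vector_derivative[OF bounded_linear_phase[of s] this]
  show "((\<lambda>t. phase s (W (s + t))) has_vector_derivative
       cscale (- \<i> * a * cinner (phase s (W (s + t))) (phase (- t) u)) (phase (- t) u)) (at t)"
    by (simp add: phase_cscale phase_phase cinner_phase_left)
qed

text \<open>Leaves the interaction picture again. \<open>SOME\<close> involves no real choice, as
  \<open>interaction_sol_unique\<close> shows.\<close>

definition evol :: "L2 \<Rightarrow> real \<Rightarrow> real \<Rightarrow> L2 \<Rightarrow> L2" where
  "evol u a t v = phase t ((SOME W. W 0 = v \<and> interaction_sol u a W) t)"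

lemma evol_eqI:
  assumes "interaction_sol u a W"
  shows "evol u a t (W 0) = phase t (W t)"
proof -
  have "(SOME V. V 0 = W 0 \<and> interaction_sol u a V) 0 = W 0 \<and> interaction_sol u a (SOME V. V 0 = W 0 \<and> interaction_sol u a V)"
    by (rule someI[of "\<lambda>V. V 0 = W 0 \<and> interaction_sol u a V" W]) (simp add: assms)
  with interaction_sol_unique[OF _ assms] show ?thesis
    unfolding evol_def by metis
qed

lemma evol_0: "evol u a 0 v = v"
  using interaction_sol_exists[of v u a] evol_eqI[of u a _ 0] by auto

lemma evol_add: "evol u a (s + t) v = evol u a s (evol u a t v)"
proof -
  obtain W where W: "W 0 = v" "interaction_sol u a W" using interaction_sol_exists by blast
  have "evol u a s (phase t (W (t + 0))) = phase s (phase t (W (t + s)))"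
    by (rule evol_eqI[OF interaction_sol_shift[OF W(2)]])
  then show ?thesis
    using evol_eqI[OF W(2)] by (simp add: W(1) phase_phase add.commute)
qed

lemma unitary_group_evol: "unitary_group (evol u a)"
  unfolding unitary_group_def unitary_op_def
proof (intro conjI allI)
  fix t v w
  obtain V where V: "V 0 = v" "interaction_sol u a V" using interaction_sol_exists by blast
  obtain W where W: "W 0 = w" "interaction_sol u a W" using interaction_sol_exists by blast
  show "evol u a t (v + w) = evol u a t v + evol u a t w"
    using evol_eqI[OF interaction_sol_add[OF V(2) W(2)]] evol_eqI[OF V(2)] evol_eqI[OF W(2)]
    by (simp add: V(1) W(1) phase_add)
  show "cinner (evol u a t v) (evol u a t w) = cinner v w"
    using cinner_interaction_sol[OF V(2) W(2), of t] evol_eqI[OF V(2)] evol_eqI[OF W(2)]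
    by (simp add: V(1) W(1) cinner_phase)
  show "evol u a t (cscale c v) = cscale c (evol u a t v)" for c
    using evol_eqI[OF interaction_sol_cscale[OF V(2)]] evol_eqI[OF V(2)]
    by (simp add: V(1) phase_cscale)
next
  fix t
  show "surj (evol u a t)"
    by (rule surjI[of _ "evol u a (- t)"]) (simp add: evol_add[symmetric] evol_0)
next
  fix v
  obtain V where V: "V 0 = v" "interaction_sol u a V" using interaction_sol_exists by blast
  have "continuous_on UNIV V"
    using V(2) unfolding interaction_sol_def
    by (intro continuous_at_imp_continuous_on ballI) (blast intro: has_vector_derivative_continuous)
  then have "continuous_on UNIV (\<lambda>t. phase t (V t))"
    by (intro continuous_on_phase continuous_intros)
  then show "continuous_on UNIV (\<lambda>t. evol u a t v)"
    using evol_eqI[OF V(2)] by (simp add: V(1))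
qed (auto simp: evol_0 evol_add fun_eq_iff)

text \<open>The difference quotient is the free one plus \<open>phase t\<close> of the quotient of
  \<open>V\<close>. The second summand converges for every \<open>v\<close>, because the
  perturbation is bounded; hence the two quotients converge for the same vectors, which identifies
  the domains, and the limits add up to -i H v.\<close>

lemma generator_evol: "generator (evol u a) = H_op u a"
proof
  fix v
  obtain V where V: "V 0 = v" "interaction_sol u a V" using interaction_sol_exists by blast
  define k where "k = cscale (- \<i> * a * cinner v u) u"
  have "((\<lambda>t. (V t - V 0) /\<^sub>R t) \<longlongrightarrow> k) (at 0)"
    using V(2)[unfolded interaction_sol_def, rule_format, of 0]
    by (simp add: has_vector_derivative_at_0 k_def V(1))
  then have k: "((\<lambda>t. phase t ((V t - v) /\<^sub>R t)) \<longlongrightarrow> k) (at 0)"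
    using tendsto_phase[OF tendsto_ident_at, of "\<lambda>t. (V t - v) /\<^sub>R t" k 0 UNIV] by (simp add: V(1))
  have split: "(evol u a t v - v) /\<^sub>R t = (phase t v - v) /\<^sub>R t + phase t ((V t - v) /\<^sub>R t)" for t
    using evol_eqI[OF V(2), of t]
    by (simp add: V(1) phase_diff phase_scaleR scaleR_add_right[symmetric])
  have deriv: "((\<lambda>t. (evol u a t v - v) /\<^sub>R t) \<longlongrightarrow> cscale (- \<i>) w + k) (at 0)" if "mult_x v = Some w" for w
    unfolding split by (intro tendsto_add k phase_has_derivative_mult_x that)
  have dom: "mult_x v \<noteq> None" if "((\<lambda>t. (evol u a t v - v) /\<^sub>R t) \<longlongrightarrow> w) (at 0)" for w
  proof (rule phase_differentiable_mult_x)
    have "((\<lambda>t. (evol u a t v - v) /\<^sub>R t - phase t ((V t - v) /\<^sub>R t)) \<longlongrightarrow> w - k) (at 0)"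
      by (intro tendsto_diff that k)
    then show "((\<lambda>t. (phase t v - v) /\<^sub>R t) \<longlongrightarrow> w - k) (at 0)" by (simp add: split)
  qed
  show "generator (evol u a) v = H_op u a v"
  proof (cases "mult_x v")
    case None
    then show ?thesis using dom by (auto simp: generator_def H_op_def)
  next
    case (Some w)
    have "Lim (at 0) (\<lambda>t. (evol u a t v - v) /\<^sub>R t) = cscale (- \<i>) w + k"
      by (rule tendsto_Lim[OF _ deriv[OF Some]]) simp
    then show ?thesis
      using deriv[OF Some] Some by (auto simp: generator_def H_op_def cscale_add k_def mult.assoc)
  qed
qed

section \<open>A unitary group is determined by its densely defined generator\<close>

lemma unitary_groupD:
  assumes "unitary_group U"
  shows "U t (v + w) = U t v + U t w" "U t (cscale c v) = cscale c (U t v)"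
    "cinner (U t v) (U t w) = cinner v w" "U 0 v = v" "U (s + t) v = U s (U t v)"
    "isCont (\<lambda>t. U t v) t"
  using assms unfolding unitary_group_def unitary_op_def
  by (auto simp: fun_eq_iff continuous_on_eq_continuous_at)

lemma unitary_group_norm: "unitary_group U \<Longrightarrow> norm (U t v) = norm v"
  by (simp add: norm_L2_def inner_L2_def unitary_groupD)

lemma unitary_group_diff: "unitary_group U \<Longrightarrow> U t (v - w) = U t v - U t w"
  using unitary_groupD(1)[of U t v "- w"] unitary_groupD(2)[of U t "-1" w] by (simp add: cscale_minus_1)

lemma unitary_group_scaleR: "unitary_group U \<Longrightarrow> U t (r *\<^sub>R v) = r *\<^sub>R U t v"
  by (simp add: scaleR_cscale unitary_groupD)

lemma generator_SomeD:
  assumes "unitary_group U" "generator U v = Some w"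
  shows "((\<lambda>t. U t v) has_vector_derivative cscale (- \<i>) w) (at 0)"
proof -
  obtain w' where w': "((\<lambda>t. (U t v - v) /\<^sub>R t) \<longlongrightarrow> w') (at 0)"
    using assms(2) unfolding generator_def by (auto split: if_splits)
  then have "Lim (at 0) (\<lambda>t. (U t v - v) /\<^sub>R t) = w'" by (intro tendsto_Lim) auto
  then have "cscale (- \<i>) w = w'" using assms(2) w' unfolding generator_def by (auto split: if_splits)
  then show ?thesis using w' by (simp add: has_vector_derivative_at_0 unitary_groupD[OF assms(1)])
qed

lemma generator_SomeI:
  assumes "unitary_group U" "((\<lambda>t. U t v) has_vector_derivative w) (at 0)"
  shows "generator U v = Some (cscale \<i> w)"
proof -
  have w: "((\<lambda>t. (U t v - v) /\<^sub>R t) \<longlongrightarrow> w) (at 0)"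
    using assms by (simp add: has_vector_derivative_at_0 unitary_groupD)
  then have "Lim (at 0) (\<lambda>t. (U t v - v) /\<^sub>R t) = w" by (intro tendsto_Lim) auto
  then show ?thesis using w by (auto simp: generator_def)
qed

lemma unitary_group_bounded_linear: "unitary_group U \<Longrightarrow> bounded_linear (U t)"
  by (rule bounded_linear_intro[where K=1])
     (simp_all add: unitary_groupD unitary_group_scaleR unitary_group_norm)

lemma unitary_group_has_vector_derivative:
  assumes U: "unitary_group U" "generator U v = Some w"
  shows "((\<lambda>t. U t v) has_vector_derivative cscale (- \<i>) (U s w)) (at s)"
proof -
  have "((\<lambda>t. t + - s) has_vector_derivative 1) (at s)"
    using has_vector_derivative_add[OF has_vector_derivative_id has_vector_derivative_const[of "- s"]] by simp
  from vector_diff_chain_at[OF this] generator_SomeD[OF U]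
  have "((\<lambda>t. U (t - s) v) has_vector_derivative cscale (- \<i>) w) (at s)"
    by (simp add: o_def)
  from bounded_linear.has_vector_derivative[OF unitary_group_bounded_linear[OF U(1), of s] this]
  show ?thesis by (simp add: unitary_groupD(5)[OF U(1), symmetric] unitary_groupD(2)[OF U(1)])
qed

lemma generator_invariant:
  assumes "unitary_group U" "generator U v = Some w"
  shows "generator U (U s v) = Some (U s w)"
proof -
  from bounded_linear.has_vector_derivative[OF unitary_group_bounded_linear[OF assms(1), of s] generator_SomeD[OF assms]]
  have "((\<lambda>t. U t (U s v)) has_vector_derivative cscale (- \<i>) (U s w)) (at 0)"
    by (simp add: unitary_groupD(5)[OF assms(1), symmetric] unitary_groupD(2)[OF assms(1)] add.commute)
  from generator_SomeI[OF assms(1) this] show ?thesis by simp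
qed

text \<open>Differentiating the conserved norm gives symmetry for any generator, without a formula
  for it.\<close>

lemma generator_skew:
  assumes "unitary_group U" "generator U v = Some w"
  shows "inner (cscale (- \<i>) w) v = 0"
proof -
  have "((\<lambda>t. inner (U t v) (U t v)) has_vector_derivative inner (U 0 v) (cscale (- \<i>) w) + inner (cscale (- \<i>) w) (U 0 v)) (at 0)"
    by (intro bounded_bilinear.has_vector_derivative[OF bounded_bilinear_inner] generator_SomeD assms)
  moreover have "(\<lambda>t. inner (U t v) (U t v)) = (\<lambda>t. inner v v)"
    using assms(1) by (simp add: inner_L2_def unitary_groupD)
  ultimately have "inner (U 0 v) (cscale (- \<i>) w) + inner (cscale (- \<i>) w) (U 0 v) = 0"
    by (metis vector_derivative_unique_at has_vector_derivative_const)
  then show ?thesis by (simp add: unitary_groupD[OF assms(1)] inner_commute)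
qed

lemma generator_diff:
  assumes "unitary_group U" "generator U v = Some w" "generator U v' = Some w'"
  shows "generator U (v - v') = Some (w - w')"
proof -
  have "((\<lambda>t. U t v - U t v') has_vector_derivative cscale (- \<i>) w - cscale (- \<i>) w') (at 0)"
    by (intro has_vector_derivative_diff generator_SomeD assms)
  then have "generator U (v - v') = Some (cscale \<i> (cscale (- \<i>) w - cscale (- \<i>) w'))"
    by (intro generator_SomeI assms) (simp add: unitary_group_diff assms)
  then show ?thesis by (simp add: cscale.diff_right)
qed

text \<open>On the common domain \<open>\<parallel>U t v - V t v\<parallel>\<^sup>2\<close> is constant, as the generator is symmetric.\<close>

lemma unitary_group_unique:
  assumes U: "unitary_group U" and V: "unitary_group V" and gen: "generator U = generator V"
    and dense: "closure (dom (generator U)) = UNIV"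
  shows "U = V"
proof -
  have eq: "U t v = V t v" if v: "v \<in> dom (generator U)" for t v
  proof -
    obtain w where w: "generator U v = Some w" "generator V v = Some w" using v gen by auto
    define d where "d t = U t v - V t v" for t
    have "((\<lambda>t. inner (d t) (d t)) has_vector_derivative 0) (at s within UNIV)" for s
    proof -
      have "(d has_vector_derivative cscale (- \<i>) (U s w) - cscale (- \<i>) (V s w)) (at s)"
        unfolding d_def by (intro has_vector_derivative_diff unitary_group_has_vector_derivative U V w)
      then have d': "(d has_vector_derivative cscale (- \<i>) (U s w - V s w)) (at s)"
        by (simp add: cscale.diff_right)
      \<comment> \<open>Both groups leave the common domain invariant, so the difference of the
        orbits stays in it and \<open>generator_skew\<close> applies to \<open>d s\<close>.\<close>
      have "generator U (d s) = Some (U s w - V s w)"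
        unfolding d_def using generator_invariant[OF U w(1)] generator_invariant[OF V w(2)]
        by (intro generator_diff U) (auto simp: gen)
      from generator_skew[OF U this] have "inner (cscale (- \<i>) (U s w - V s w)) (d s) = 0" .
      with bounded_bilinear.has_vector_derivative[OF bounded_bilinear_inner d' d'] show ?thesis
        by (simp add: inner_commute)
    qed
    then obtain c where c: "\<And>s. s \<in> UNIV \<Longrightarrow> inner (d s) (d s) = c"
      by (rule has_vector_derivative_zero_constant[OF convex_UNIV]) auto
    have "inner (d t) (d t) = inner (d 0) (d 0)" by (simp add: c)
    then show ?thesis by (simp add: d_def unitary_groupD[OF U] unitary_groupD[OF V])
  qed
  have "U t v = V t v" for t v
  proof -
    have "v \<in> closure (dom (generator U))" using dense by simp
    then obtain x where x: "\<And>n. x n \<in> dom (generator U)" "x \<longlonglongrightarrow> v"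
      unfolding closure_sequential by auto
    have U_lim: "(\<lambda>n. U t (x n)) \<longlonglongrightarrow> U t v"
      by (rule bounded_linear.tendsto[OF unitary_group_bounded_linear[OF U] x(2)])
    have "(\<lambda>n. U t (x n)) \<longlonglongrightarrow> V t v"
      unfolding eq[OF x(1)] by (rule bounded_linear.tendsto[OF unitary_group_bounded_linear[OF V] x(2)])
    with U_lim show ?thesis by (rule LIMSEQ_unique)
  qed
  then show ?thesis by (simp add: fun_eq_iff)
qed

lemma dom_H_op: "dom (H_op u a) = dom mult_x"
  by (auto simp: H_op_def)

lemma dense_dom_mult_x: "closure (dom mult_x) = UNIV"
proof -
  have "v \<in> closure (dom mult_x)" for v
  proof -
    define f where "f = rep_L2 v"
    have f: "sq_integrable f" "v = L2_of f" by (simp_all add: f_def)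
    have [measurable]: "f \<in> borel_measurable borel" by (rule sq_integrable_measurable[OF f(1)])
    \<comment> \<open>On [-n, n] multiplication by x is bounded by n, so the truncations lie in the
      domain.\<close>
    define g where "g n x = indicator {- real n..real n} x * f x" for n x
    have [measurable]: "g n \<in> borel_measurable borel" for n unfolding g_def by measurable
    have g_le: "cmod (g n x) \<le> cmod (f x)" for n x by (auto simp: g_def indicator_def)
    have g: "sq_integrable (g n)" for n by (rule sq_integrable_bound[OF f(1) _ g_le]) measurable
    have "sq_integrable (\<lambda>x. of_real x * g n x)" for n
    proof (rule sq_integrable_bound[OF sq_integrable_cmult[OF f(1), of "of_nat n"]])
      show "cmod (complex_of_real x * g n x) \<le> cmod (of_nat n * f x)" for x
        by (auto simp: g_def indicator_def norm_mult intro!: mult_right_mono)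
    qed measurable
    then have dom: "L2_of (g n) \<in> dom mult_x" for n using mult_x_L2_of[OF g] by blast
    have "(\<lambda>n. L2_of (\<lambda>x. g n x - f x)) \<longlonglongrightarrow> 0"
    proof (rule L2_dominated_convergence[OF f(1)])
      show "cmod (g n x - f x) \<le> cmod (f x)" for n x by (auto simp: g_def indicator_def)
      fix x
      obtain N where "\<bar>x\<bar> \<le> real N" using real_arch_simple by blast
      then have "eventually (\<lambda>n. g n x - f x = 0) sequentially"
        by (intro eventually_sequentiallyI[of N]) (auto simp: g_def indicator_def)
      then show "(\<lambda>n. g n x - f x) \<longlonglongrightarrow> 0" by (rule tendsto_eventually)
    qed measurable
    then have "(\<lambda>n. L2_of (g n)) \<longlonglongrightarrow> v" by (simp add: L2_of_diff g f LIM_zero_iff)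
    with dom show ?thesis unfolding closure_sequential by (intro exI[of _ "\<lambda>n. L2_of (g n)"]) auto
  qed
  then show ?thesis by auto
qed

text \<open>This discharges the definite description in \<open>exp_group\<close>:
  \<open>evol\<close> witnesses existence, and density of the domain gives uniqueness.\<close>

lemma exp_group_H_op:
  "unitary_group (exp_group (H_op u a))" "generator (exp_group (H_op u a)) = H_op u a"
proof -
  have "\<exists>!U. unitary_group U \<and> generator U = H_op u a"
  proof (rule ex1I[of _ "evol u a"])
    fix U assume "unitary_group U \<and> generator U = H_op u a"
    then show "U = evol u a"
      by (intro unitary_group_unique unitary_group_evol)
         (auto simp: generator_evol dom_H_op dense_dom_mult_x)
  qed (simp add: unitary_group_evol generator_evol)
  from theI'[OF this] show "unitary_group (exp_group (H_op u a))" "generator (exp_group (H_op u a)) = H_op u a"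
    by (simp_all add: exp_group_def)
qed

section \<open>Sojourn time and resolvent\<close>

text \<open>\<open>\<langle>w, p\<rangle>\<close> is \<open>i F\<close> times the Laplace transform of \<open>\<langle>U t p, p\<rangle>\<close>, whose modulus is even in \<open>t\<close>;
  \<open>s\<close> is the free parameter of the inequality \<open>2 |f| e\<^sup>-\<^sup>k\<^sup>t \<le> s e\<^sup>-\<^sup>2\<^sup>k\<^sup>t + |f|\<^sup>2 / s\<close>.\<close>

lemma resolvent_le_sojourn_time:
  assumes U: "unitary_group U" and gen: "generator U w = Some w'"
    and w': "w' - cscale z w = cscale F p"
    and k: "k = Im z" "0 < k" and s: "0 < s"
    and T: "(\<integral>\<^sup>+t. ennreal ((cmod (cinner (U t p) p))\<^sup>2) \<partial>lborel) \<le> ennreal T" "0 \<le> T"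
  shows "cmod (cinner w p) \<le> cmod F * (s / (4 * k) + T / (4 * s))"
proof -
  define f where "f t = cinner (U t p) p" for t
  have f_cont: "continuous_on S f" for S
    unfolding f_def by (intro cinner.continuous_on continuous_intros)
      (auto intro: continuous_at_imp_continuous_on unitary_groupD(6)[OF U])
  have f_neg: "cmod (f (- t)) = cmod (f t)" for t
  proof -
    have "cinner (U t (U (- t) p)) (U t p) = cinner (U (- t) p) p"
      by (rule unitary_groupD(3)[OF U])
    then have "f (- t) = cnj (f t)"
      by (simp add: f_def unitary_groupD(5)[OF U, symmetric] unitary_groupD(4)[OF U] cinner_commute[of p])
    then show ?thesis by simp
  qed
  \<comment> \<open>As (H - z) w = F p, the factor exp(izt) cancels the part of the derivative
    proportional to \<open>U t w\<close>; only the source term with \<open>f\<close>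
    survives.\<close>
  define h where "h t = exp (\<i> * z * of_real t) * cinner (U t w) p" for t
  have h': "(h has_vector_derivative - \<i> * F * exp (\<i> * z * of_real t) * f t) (at t)" for t
  proof -
    have w'_eq: "w' = cscale F p + cscale z w" using w' by (simp add: algebra_simps)
    have "((\<lambda>t. exp (\<i> * z * of_real t)) has_vector_derivative (\<i> * z * exp (\<i> * z * of_real t))) (at t)"
      by (auto intro!: derivative_eq_intros has_vector_derivative_real_field)
    moreover have "((\<lambda>t. cinner (U t w) p) has_vector_derivative cinner (cscale (- \<i>) (U t w')) p) (at t)"
      using bounded_linear.has_vector_derivative[OF cinner.bounded_linear_left unitary_group_has_vector_derivative[OF U gen]] .
    ultimately have "(h has_vector_derivative exp (\<i> * z * of_real t) * cinner (cscale (- \<i>) (U t w')) p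
        + \<i> * z * exp (\<i> * z * of_real t) * cinner (U t w) p) (at t)"
      unfolding h_def by (rule has_vector_derivative_mult)
    moreover have "cinner (cscale (- \<i>) (U t w')) p = - \<i> * F * f t - \<i> * z * cinner (U t w) p"
      by (simp add: w'_eq f_def unitary_groupD[OF U] cinner_cscale_left cinner_add_left cscale_add algebra_simps)
    ultimately show ?thesis by (simp add: algebra_simps)
  qed
  have f2: "(\<lambda>t. (cmod (f t))\<^sup>2) integrable_on {a..b}" for a b
    by (intro integrable_continuous_interval continuous_intros f_cont)
  \<comment> \<open>The time integral of \<open>h'\<close> runs over a half-line only, which carries
    at most half of the sojourn time; hence \<open>T / (4 * s)\<close> in the conclusion.\<close>
  have f2_le: "integral {0..R} (\<lambda>t. (cmod (f t))\<^sup>2) \<le> T / 2" if R: "0 \<le> R" for R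
  proof -
    have "((\<lambda>t. (cmod (f t))\<^sup>2) has_integral integral {0..R} (\<lambda>t. (cmod (f t))\<^sup>2)) {0..R}"
      by (rule integrable_integral[OF f2])
    then have "((\<lambda>t. (cmod (f t))\<^sup>2) has_integral integral {0..R} (\<lambda>t. (cmod (f t))\<^sup>2)) {-R..0}"
      by (subst (asm) has_integral_reflect_real[symmetric]) (simp add: f_neg)
    then have "integral {-R..0} (\<lambda>t. (cmod (f t))\<^sup>2) = integral {0..R} (\<lambda>t. (cmod (f t))\<^sup>2)"
      by (rule integral_unique)
    then have eq: "2 * integral {0..R} (\<lambda>t. (cmod (f t))\<^sup>2) = integral {-R..R} (\<lambda>t. (cmod (f t))\<^sup>2)"
      using Henstock_Kurzweil_Integration.integral_combine[of "-R" 0 R, OF _ _ f2] R by simp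
    have "ennreal (integral {-R..R} (\<lambda>t. (cmod (f t))\<^sup>2)) = (\<integral>\<^sup>+t. ennreal (indicator {-R..R} t * (cmod (f t))\<^sup>2) \<partial>lborel)"
    proof -
      have "(\<integral>\<^sup>+t. ennreal (indicator {-R..R} t * (cmod (f t))\<^sup>2) \<partial>lborel) =
          (\<integral>\<^sup>+t\<in>{-R..R}. ennreal ((cmod (f t))\<^sup>2) \<partial>lborel)"
        by (intro nn_integral_cong) (auto simp: indicator_def)
      also have "\<dots> = ennreal (integral {-R..R} (\<lambda>t. (cmod (f t))\<^sup>2))"
        by (rule nn_integral_has_integral_lebesgue') (auto intro: integrable_integral[OF f2])
      finally show ?thesis by simp
    qed
    also have "\<dots> \<le> (\<integral>\<^sup>+t. ennreal ((cmod (f t))\<^sup>2) \<partial>lborel)"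
      by (intro nn_integral_mono ennreal_leI) (auto simp: indicator_def)
    also have "\<dots> \<le> ennreal T" using T(1) by (simp add: f_def)
    finally show ?thesis using eq T(2) by (simp add: ennreal_le_iff)
  qed
  \<comment> \<open>\<open>U R\<close> is isometric, so the boundary term decays like
    \<open>exp (- k * R)\<close>. The limit in \<open>R\<close> is then taken in a scalar
    inequality, and no improper integral occurs.\<close>
  have bound: "cmod (h 0) - exp (- k * R) * (norm w * norm p) \<le> cmod F * (s / (4 * k) + T / (4 * s))" if R: "0 \<le> R" for R
  proof -
    define g where "g t = cmod F * (s / 2 * exp (- (2 * k) * t) + 1 / (2 * s) * (cmod (f t))\<^sup>2)" for t
    have e: "((\<lambda>t. exp (- (2 * k) * t)) has_integral - 1 / (2 * k) * exp (- (2 * k) * R) - - 1 / (2 * k) * exp (- (2 * k) * 0)) {0..R}"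
      using R k by (intro fundamental_theorem_of_calculus)
        (auto intro!: derivative_eq_intros simp: has_real_derivative_iff_has_vector_derivative[symmetric])
    have g_int: "(g has_integral cmod F * (s / 2 * (- 1 / (2 * k) * exp (- (2 * k) * R) - - 1 / (2 * k) * exp (- (2 * k) * 0)) +
        1 / (2 * s) * integral {0..R} (\<lambda>t. (cmod (f t))\<^sup>2))) {0..R}"
      unfolding g_def
      by (intro has_integral_mult_right has_integral_add e integrable_integral[OF f2])
    have h_int: "((\<lambda>t. - \<i> * F * exp (\<i> * z * of_real t) * f t) has_integral h R - h 0) {0..R}"
      using h' R by (intro fundamental_theorem_of_calculus) (auto intro: has_vector_derivative_at_within)
    have exp_norm: "cmod (exp (\<i> * z * of_real t)) = exp (- k * t)" for t
      by (simp add: k(1))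
    have "norm (h R - h 0) \<le> integral {0..R} g"
    proof -
      have "norm (integral {0..R} (\<lambda>t. - \<i> * F * exp (\<i> * z * of_real t) * f t)) \<le> integral {0..R} g"
      proof (rule integral_norm_bound_integral)
        fix t
        define e where "e = exp (- k * t)"
        have "0 \<le> (s * e - cmod (f t))\<^sup>2" by simp
        then have "e * cmod (f t) \<le> s / 2 * e\<^sup>2 + 1 / (2 * s) * (cmod (f t))\<^sup>2"
          using s by (simp add: power2_eq_square field_simps)
        moreover have "e\<^sup>2 = exp (- (2 * k) * t)"
          unfolding e_def by (simp add: exp_double[symmetric] mult.assoc)
        ultimately have "cmod F * (e * cmod (f t)) \<le> g t"
          unfolding g_def by (intro mult_left_mono) auto
        moreover have "norm (- \<i> * F * exp (\<i> * z * of_real t) * f t) = cmod F * (e * cmod (f t))"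
          by (simp only: norm_mult exp_norm norm_minus_cancel norm_ii e_def)
        ultimately show "norm (- \<i> * F * exp (\<i> * z * of_real t) * f t) \<le> g t" by simp
      qed (use h_int g_int in \<open>auto simp: integrable_on_def\<close>)
      then show ?thesis by (simp only: integral_unique[OF h_int])
    qed
    also have "\<dots> \<le> cmod F * (s / (4 * k) + T / (4 * s))"
    proof -
      have "s / 2 * (- 1 / (2 * k) * exp (- (2 * k) * R) - - 1 / (2 * k) * exp (- (2 * k) * 0)) \<le> s / (4 * k)"
        using s k by (simp add: field_simps)
      moreover have "1 / (2 * s) * integral {0..R} (\<lambda>t. (cmod (f t))\<^sup>2) \<le> 1 / (2 * s) * (T / 2)"
        using f2_le[OF R] s by (intro mult_left_mono) auto
      moreover have "1 / (2 * s) * (T / 2) = T / (4 * s)" by simp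
      ultimately show ?thesis unfolding integral_unique[OF g_int]
        by (intro mult_left_mono) (simp_all only: add_mono norm_ge_zero)
    qed
    finally have "norm (h R - h 0) \<le> cmod F * (s / (4 * k) + T / (4 * s))" .
    moreover have "norm (h R) \<le> exp (- k * R) * (norm w * norm p)"
      unfolding h_def norm_mult exp_norm
      using cinner_Cauchy_Schwarz[of "U R w" p] by (intro mult_left_mono) (auto simp: unitary_group_norm[OF U])
    moreover have "norm (h 0) \<le> norm (h R) + norm (h R - h 0)"
      using norm_triangle_ineq4[of "h R" "h R - h 0"] by simp
    ultimately show ?thesis by simp
  qed
  have "((\<lambda>R. cmod (h 0) - exp (- k * R) * (norm w * norm p)) \<longlongrightarrow> cmod (h 0) - 0 * (norm w * norm p)) at_top"
  proof (intro tendsto_intros)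
    have "filterlim (\<lambda>R. - k * R) at_bot at_top"
      using k by (intro filterlim_tendsto_neg_mult_at_bot[OF tendsto_const] filterlim_ident) auto
    then show "((\<lambda>R. exp (- k * R)) \<longlongrightarrow> 0) at_top"
      by (rule filterlim_compose[OF exp_at_bot])
  qed
  then have "cmod (h 0) - 0 * (norm w * norm p) \<le> cmod F * (s / (4 * k) + T / (4 * s))"
    by (rule tendsto_upperbound) (use bound in \<open>auto intro: eventually_at_top_linorderI[of 0]\<close>)
  then show ?thesis by (simp add: h_def unitary_groupD[OF U])
qed

section \<open>Boundary values of Cauchy integrals\<close>

text \<open>Averaging over the reflection about \<open>l\<close> separates even and odd parts: the
  odd part will carry the principal value, the even part the Poisson integral.\<close>

lemma lborel_integral_fold:
  fixes h :: "real \<Rightarrow> 'a :: {banach, second_countable_topology}"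
  assumes h: "integrable lborel h"
  shows "integrable lborel (\<lambda>y. h (l + y) + h (l - y))"
    and "(LINT x|lborel. h x) = (1/2) *\<^sub>R (LINT y|lborel. h (l + y) + h (l - y))"
proof -
  have p: "integrable lborel (\<lambda>y. h (l + y))" "(LINT y|lborel. h (l + y)) = (LINT x|lborel. h x)"
    using lborel_integrable_real_affine[OF h, of 1 l] lborel_integral_real_affine[of 1 h l] by simp_all
  have m: "integrable lborel (\<lambda>y. h (l - y))" "(LINT y|lborel. h (l - y)) = (LINT x|lborel. h x)"
    using lborel_integrable_real_affine[OF h, of "-1" l] lborel_integral_real_affine[of "-1" h l] by simp_all
  show "integrable lborel (\<lambda>y. h (l + y) + h (l - y))" using p m by simp
  show "(LINT x|lborel. h x) = (1/2) *\<^sub>R (LINT y|lborel. h (l + y) + h (l - y))"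
    using p m by (simp add: scaleR_2[symmetric])
qed

lemma Poisson_kernel:
  assumes k: "0 < (k::real)"
  shows "integrable lborel (\<lambda>y. k / (y\<^sup>2 + k\<^sup>2))" "(LINT y|lborel. k / (y\<^sup>2 + k\<^sup>2)) = pi"
proof -
  have pos: "0 < y\<^sup>2 + k\<^sup>2" for y using k by (simp add: add_nonneg_pos)
  have der: "((\<lambda>y. arctan (y / k)) has_real_derivative k / (y\<^sup>2 + k\<^sup>2)) (at y)" for y
  proof -
    have "((\<lambda>y. arctan (y / k)) has_real_derivative inverse (1 + (y / k)\<^sup>2) * (1 / k)) (at y)"
      by (rule DERIV_chain2[OF DERIV_arctan]) (use k in \<open>auto intro!: derivative_eq_intros\<close>)
    moreover have "inverse (1 + (y / k)\<^sup>2) * (1 / k) = k / (y\<^sup>2 + k\<^sup>2)"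
    proof -
      have "1 + (y / k)\<^sup>2 = (y\<^sup>2 + k\<^sup>2) / k\<^sup>2" using k by (simp add: field_simps)
      then show ?thesis using k pos[of y] by (simp add: power2_eq_square)
    qed
    ultimately show ?thesis by simp
  qed
  have top: "((\<lambda>y. arctan (y / k)) \<longlongrightarrow> pi / 2) at_top"
    using filterlim_tendsto_pos_mult_at_top[OF tendsto_const, of "1 / k" "\<lambda>y. y" at_top] k
    by (intro filterlim_compose[OF tendsto_arctan_at_top]) (simp add: filterlim_ident)
  have bot: "((\<lambda>y. arctan (y / k)) \<longlongrightarrow> - (pi / 2)) at_bot"
    using filterlim_compose[OF tendsto_minus[OF top] filterlim_uminus_at_top_at_bot]
    by (simp add: arctan_minus)
  have *: "set_integrable lborel (einterval (-\<infinity>) \<infinity>) (\<lambda>y. k / (y\<^sup>2 + k\<^sup>2))"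
    "(LBINT y=-\<infinity>..\<infinity>. k / (y\<^sup>2 + k\<^sup>2)) = pi / 2 - - (pi / 2)"
    by (rule interval_integral_FTC_nonneg[where F="\<lambda>y. arctan (y / k)"];
        use der top bot pos k in \<open>auto simp: ereal_tendsto_simps less_imp_le intro!: continuous_intros simp: less_imp_neq[symmetric]\<close>)+
  show "integrable lborel (\<lambda>y. k / (y\<^sup>2 + k\<^sup>2))" using *(1) by (simp add: set_integrable_def)
  show "(LINT y|lborel. k / (y\<^sup>2 + k\<^sup>2)) = pi"
    using *(2) by (simp add: interval_lebesgue_integral_def set_lebesgue_integral_def)
qed

lemma set_integral_hole_tendsto:
  fixes h :: "real \<Rightarrow> 'a :: {banach, second_countable_topology}"
  assumes h: "integrable lborel h"
  shows "((\<lambda>\<epsilon>. LINT x:{x. \<epsilon> \<le> \<bar>x - l\<bar>}|lborel. h x) \<longlongrightarrow> (LINT x|lborel. h x)) (at_right 0)"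
  unfolding tendsto_at_iff_sequentially
proof (intro allI impI)
  fix s :: "nat \<Rightarrow> real" assume s: "\<forall>i. s i \<in> {0<..} - {0}" "s \<longlonglongrightarrow> 0"
  have "(\<lambda>n. LINT x|lborel. indicator {x. s n \<le> \<bar>x - l\<bar>} x *\<^sub>R h x) \<longlonglongrightarrow> (LINT x|lborel. h x)"
  proof (rule integral_dominated_convergence[where w="\<lambda>x. norm (h x)"])
    have [measurable]: "h \<in> borel_measurable borel" using h by auto
    show "(\<lambda>x. indicator {x. s n \<le> \<bar>x - l\<bar>} x *\<^sub>R h x) \<in> borel_measurable lborel" for n
      by measurable
    have "AE x in lborel. x \<noteq> l" by (rule AE_lborel_singleton)
    then show "AE x in lborel. (\<lambda>n. indicator {x. s n \<le> \<bar>x - l\<bar>} x *\<^sub>R h x) \<longlonglongrightarrow> h x"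
    proof eventually_elim
      fix x assume "x \<noteq> l"
      then have "eventually (\<lambda>n. s n < \<bar>x - l\<bar>) sequentially"
        by (intro order_tendstoD(2)[OF s(2)]) auto
      then have "eventually (\<lambda>n. indicator {x. s n \<le> \<bar>x - l\<bar>} x *\<^sub>R h x = h x) sequentially"
        by eventually_elim (simp add: indicator_def)
      then show "(\<lambda>n. indicator {x. s n \<le> \<bar>x - l\<bar>} x *\<^sub>R h x) \<longlonglongrightarrow> h x"
        by (rule tendsto_eventually)
    qed
  qed (use h in \<open>auto simp: indicator_def\<close>)
  then show "((\<lambda>\<epsilon>. LINT x:{x. \<epsilon> \<le> \<bar>x - l\<bar>}|lborel. h x) \<circ> s) \<longlonglongrightarrow> (LINT x|lborel. h x)"
    by (simp add: set_lebesgue_integral_def o_def)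
qed

text \<open>Smoothness is expressed by differences instead of derivatives. The estimates of the
  Cauchy integral use precisely these bounds, and for |phi|^2 they can be had without
  differentiating a quotient at its removable singularity.\<close>

locale smooth_density =
  fixes psi :: "real \<Rightarrow> real" and M0 M1 M2 :: real
  assumes nonneg: "\<And>x. 0 \<le> psi x"
    and bounded: "\<And>x. psi x \<le> M0"
    and Lipschitz: "\<And>x y. \<bar>psi x - psi y\<bar> \<le> M1 * \<bar>x - y\<bar>"
    and second_diff: "\<And>x y. \<bar>psi (x + y) + psi (x - y) - 2 * psi x\<bar> \<le> M2 * y\<^sup>2"
    and integrable: "integrable lborel psi"
begin

definition "mass = (LINT x|lborel. psi x)"
definition "cauchy z = (LINT x|lborel. complex_of_real (psi x) / (complex_of_real x - z))"
text \<open>The principal value of psi(x) / (x - l), folded about \<open>l\<close> into an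
  absolutely convergent integral; \<open>pv_psi\<close> proves the identification.\<close>

definition "hilbert l = (LINT y|lborel. (psi (l + y) - psi (l - y)) / y) / 2"

lemma measurable_psi [measurable]: "psi \<in> borel_measurable borel"
  using integrable by auto

lemma mass_nonneg: "0 \<le> mass"
  by (simp add: mass_def nonneg)

lemma M_nonneg: "0 \<le> M0" "0 \<le> M1" "0 \<le> M2"
  using nonneg[of 0] bounded[of 0] Lipschitz[of 1 0] second_diff[of 0 1] by auto

lemma odd_part_le: "\<bar>(psi (l + y) - psi (l - y)) / y\<bar> \<le> 2 * M1"
  using Lipschitz[of "l + y" "l - y"] M_nonneg by (cases "y = 0") (auto simp: field_simps abs_mult)

lemma integrable_translates: "integrable lborel (\<lambda>y. psi (l + y) + psi (l - y))"
  by (rule lborel_integral_fold[OF integrable])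

lemma integral_translates: "(LINT y|lborel. psi (l + y) + psi (l - y)) = 2 * mass"
  using lborel_integral_fold(2)[OF integrable, of l] by (simp add: mass_def)

text \<open>Near 0 the Lipschitz bound controls the quotient, and for |y| > 1 the division only
  makes it smaller. The integral of this majorant does not depend on \<open>l\<close>, so
  \<open>hilbert_le\<close> is uniform.\<close>

lemma odd_part_le':
  "\<bar>(psi (l + y) - psi (l - y)) / y\<bar> \<le> 2 * M1 * indicator {-1..1} y + (psi (l + y) + psi (l - y))"
proof (cases "\<bar>y\<bar> \<le> 1")
  case True
  then show ?thesis using odd_part_le[of l y] nonneg[of "l + y"] nonneg[of "l - y"]
    by (simp add: indicator_def abs_le_iff)
next
  case False
  then have "\<bar>psi (l + y) - psi (l - y)\<bar> / \<bar>y\<bar> \<le> \<bar>psi (l + y) - psi (l - y)\<bar> / 1"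
    by (intro divide_left_mono) auto
  then show ?thesis using False nonneg[of "l + y"] nonneg[of "l - y"]
    by (auto simp: indicator_def)
qed

lemma integrable_bound_odd_part:
  "integrable lborel (\<lambda>y. 2 * M1 * indicator {-1..1} y + (psi (l + y) + psi (l - y)))"
  by (intro Bochner_Integration.integrable_add integrable_mult_right integrable_translates) auto

lemma integrable_odd_part: "integrable lborel (\<lambda>y. (psi (l + y) - psi (l - y)) / y)"
  by (rule Bochner_Integration.integrable_bound[OF integrable_bound_odd_part[of l]])
     (use odd_part_le'[of l] in \<open>auto intro!: AE_I2 order_trans[OF _ abs_ge_self]\<close>)

lemma hilbert_le: "\<bar>hilbert l\<bar> \<le> 2 * M1 + mass"
proof -
  have "\<bar>LINT y|lborel. (psi (l + y) - psi (l - y)) / y\<bar>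
     \<le> (LINT y|lborel. 2 * M1 * indicator {-1..1} y + (psi (l + y) + psi (l - y)))"
    using odd_part_le'
    by (intro order_trans[OF integral_abs_bound] integral_mono integrable_abs integrable_odd_part integrable_bound_odd_part)
  also have "\<dots> = 4 * M1 + 2 * mass"
    using integrable_translates[of l] by (subst Bochner_Integration.integral_add) (auto simp: integral_translates)
  finally show ?thesis by (simp add: hilbert_def)
qed

lemma integrable_cauchy:
  assumes "Im z \<noteq> 0"
  shows "integrable lborel (\<lambda>x. complex_of_real (psi x) / (complex_of_real x - z))"
proof (rule Bochner_Integration.integrable_bound)
  show "integrable lborel (\<lambda>x. psi x / \<bar>Im z\<bar>)" using integrable by simp
  show "AE x in lborel. norm (complex_of_real (psi x) / (complex_of_real x - z)) \<le> norm (psi x / \<bar>Im z\<bar>)"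
  proof (intro AE_I2)
    fix x
    have "\<bar>Im z\<bar> \<le> cmod (complex_of_real x - z)" using abs_Im_le_cmod[of "complex_of_real x - z"] by simp
    then show "norm (complex_of_real (psi x) / (complex_of_real x - z)) \<le> norm (psi x / \<bar>Im z\<bar>)"
      using assms nonneg[of x] by (auto simp: norm_divide intro!: divide_left_mono mult_pos_pos)
  qed
qed measurable

text \<open>Folded about \<open>l\<close>, the Cauchy kernel acts on the odd part by y / (y^2 + k^2)
  and on the even part by i k / (y^2 + k^2). Subtracting the limit leaves the odd quotient times k^2
  / (y^2 + k^2), which is k times a Poisson kernel, and the second difference \<open>S\<close> times
  k / (y^2 + k^2). A first-order bound on \<open>S\<close> would only give an error of order k
  log(1/k); the quadratic bound gives O(k).\<close>

lemma cauchy_boundary: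
  assumes k: "0 < k"
  shows "cmod (cauchy (Complex l k) - hilbert l - \<i> * pi * psi l) \<le> pi * (M1 + M2 / 2 + M0) * k"
proof -
  define a b where "a y = psi (l + y)" and "b y = psi (l - y)" for y
  define S where "S y = a y + b y - 2 * psi l" for y
  have ab: "a \<in> borel_measurable borel" "b \<in> borel_measurable borel"
    unfolding a_def b_def by measurable
  note [measurable] = ab
  have q: "0 < y\<^sup>2 + k\<^sup>2" for y using k by (simp add: add_nonneg_pos)
  define D where "D y = of_real (a y) / (of_real (l + y) - Complex l k) + of_real (b y) / (of_real (l - y) - Complex l k)" for y
  have D: "integrable lborel D" "cauchy (Complex l k) = (1/2) *\<^sub>R (LINT y|lborel. D y)"
    using lborel_integral_fold[OF integrable_cauchy[of "Complex l k"], of l] k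
    by (simp_all add: D_def[abs_def] a_def b_def cauchy_def)
  define E where "E y = complex_of_real ((a y - b y) / y)" for y
  have E: "integrable lborel E" "complex_of_real (hilbert l) = (1/2) *\<^sub>R (LINT y|lborel. E y)"
  proof -
    show "integrable lborel E"
      unfolding E_def[abs_def] a_def b_def by (rule integrable_of_real[OF integrable_odd_part])
    have "(LINT y|lborel. E y) = of_real (LINT y|lborel. (a y - b y) / y)"
      by (simp only: E_def integral_complex_of_real)
    then show "complex_of_real (hilbert l) = (1/2) *\<^sub>R (LINT y|lborel. E y)"
      by (simp add: hilbert_def a_def b_def scaleR_conv_of_real)
  qed
  define G where "G y = \<i> * of_real (2 * psi l) * complex_of_real (k / (y\<^sup>2 + k\<^sup>2))" for y
  have G: "integrable lborel G" "\<i> * pi * psi l = (1/2) *\<^sub>R (LINT y|lborel. G y)"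
  proof -
    have "integrable lborel (\<lambda>y. complex_of_real (k / (y\<^sup>2 + k\<^sup>2)))"
      by (rule integrable_of_real) (rule Poisson_kernel[OF k])
    moreover have "(LINT y|lborel. complex_of_real (k / (y\<^sup>2 + k\<^sup>2))) = of_real pi"
      by (simp only: integral_complex_of_real Poisson_kernel[OF k])
    ultimately show "integrable lborel G" "\<i> * pi * psi l = (1/2) *\<^sub>R (LINT y|lborel. G y)"
      unfolding G_def[abs_def] by (simp_all only: integrable_mult_right integral_mult_right_zero)
        (simp add: scaleR_conv_of_real)
  qed
  have pointwise: "D y - E y - G y = Complex (- ((a y - b y) / y * (k\<^sup>2 / (y\<^sup>2 + k\<^sup>2)))) (S y * (k / (y\<^sup>2 + k\<^sup>2)))"
    if "y \<noteq> 0" for y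
  proof -
    have nz: "y\<^sup>2 + k\<^sup>2 \<noteq> 0" using q[of y] by (metis less_irrefl)
    have "D y = Complex ((a y - b y) * y / (y\<^sup>2 + k\<^sup>2)) ((a y + b y) * k / (y\<^sup>2 + k\<^sup>2))"
      by (simp add: D_def complex_eq_iff Re_divide Im_divide add_divide_distrib[symmetric] diff_divide_distrib[symmetric] algebra_simps)
    moreover have "(a y - b y) * y / (y\<^sup>2 + k\<^sup>2) - (a y - b y) / y = - ((a y - b y) / y * (k\<^sup>2 / (y\<^sup>2 + k\<^sup>2)))"
      using nz that by (simp add: divide_simps) (simp add: algebra_simps power2_eq_square)
    moreover have "(a y + b y) * k / (y\<^sup>2 + k\<^sup>2) - 2 * psi l * (k / (y\<^sup>2 + k\<^sup>2)) = S y * (k / (y\<^sup>2 + k\<^sup>2))"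
      using nz by (simp add: S_def divide_simps) (simp add: algebra_simps)
    ultimately show ?thesis by (simp add: E_def G_def complex_eq_iff)
  qed
  have bound: "cmod (D y - E y - G y) \<le> 2 * M1 * k * (k / (y\<^sup>2 + k\<^sup>2)) + (M2 + 2 * M0) * k * (1 / (y\<^sup>2 + 1\<^sup>2))"
    if "y \<noteq> 0" for y
  proof -
    have "cmod (D y - E y - G y) \<le> \<bar>(a y - b y) / y * (k\<^sup>2 / (y\<^sup>2 + k\<^sup>2))\<bar> + \<bar>S y * (k / (y\<^sup>2 + k\<^sup>2))\<bar>"
      unfolding pointwise[OF that] using cmod_le[of "Complex (- ((a y - b y) / y * (k\<^sup>2 / (y\<^sup>2 + k\<^sup>2)))) (S y * (k / (y\<^sup>2 + k\<^sup>2)))"]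
      by simp
    also have "\<bar>(a y - b y) / y * (k\<^sup>2 / (y\<^sup>2 + k\<^sup>2))\<bar> = \<bar>(a y - b y) / y\<bar> * (k\<^sup>2 / (y\<^sup>2 + k\<^sup>2))"
      using q[of y] by (simp add: abs_mult)
    also have "\<bar>(a y - b y) / y\<bar> * (k\<^sup>2 / (y\<^sup>2 + k\<^sup>2)) \<le> 2 * M1 * (k\<^sup>2 / (y\<^sup>2 + k\<^sup>2))"
      using odd_part_le[of l y] q[of y] unfolding a_def b_def by (intro mult_right_mono) auto
    also have "2 * M1 * (k\<^sup>2 / (y\<^sup>2 + k\<^sup>2)) = 2 * M1 * k * (k / (y\<^sup>2 + k\<^sup>2))"
      by (simp add: power2_eq_square)
    also have "\<bar>S y * (k / (y\<^sup>2 + k\<^sup>2))\<bar> = \<bar>S y\<bar> * (k / (y\<^sup>2 + k\<^sup>2))"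
      using q[of y] k by (simp add: abs_mult)
    \<comment> \<open>The bound \<open>M2 * y\<^sup>2\<close> serves small y, and
      \<open>2 * M0\<close> serves large y. Adding the first to y^2 times the second replaces the
      kernel by the Poisson kernel of width 1, uniformly in \<open>k\<close>.\<close>
    also have "\<bar>S y\<bar> * (k / (y\<^sup>2 + k\<^sup>2)) \<le> (M2 + 2 * M0) * k * (1 / (y\<^sup>2 + 1\<^sup>2))"
    proof -
      have "\<bar>S y\<bar> \<le> 2 * M0"
        using nonneg[of "l + y"] nonneg[of "l - y"] nonneg[of l] bounded[of "l + y"] bounded[of "l - y"] bounded[of l]
        by (simp add: S_def a_def b_def abs_le_iff)
      moreover have S: "\<bar>S y\<bar> \<le> M2 * y\<^sup>2" using second_diff[of l y] by (simp add: S_def a_def b_def)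
      ultimately have "\<bar>S y\<bar> * (y\<^sup>2 + 1) \<le> (M2 + 2 * M0) * y\<^sup>2"
        using mult_right_mono[of "\<bar>S y\<bar>" "2 * M0" "y\<^sup>2"] by (simp add: algebra_simps)
      also have "\<dots> \<le> (M2 + 2 * M0) * (y\<^sup>2 + k\<^sup>2)"
        using M_nonneg by (intro mult_left_mono) auto
      finally have "\<bar>S y\<bar> * (y\<^sup>2 + 1) * k \<le> (M2 + 2 * M0) * (y\<^sup>2 + k\<^sup>2) * k"
        using k by (intro mult_right_mono) auto
      moreover have "0 < y\<^sup>2 + 1" by (simp add: add_nonneg_pos)
      ultimately show ?thesis using q[of y] by (simp add: divide_simps mult_ac)
    qed
    finally show ?thesis by simp
  qed
  have int: "integrable lborel (\<lambda>y. D y - E y - G y)" using D E G by auto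
  have "cauchy (Complex l k) - hilbert l - \<i> * pi * psi l = (1/2) *\<^sub>R (LINT y|lborel. D y - E y - G y)"
    using D E G by (simp add: scaleR_diff_right)
  then have "cmod (cauchy (Complex l k) - hilbert l - \<i> * pi * psi l) = 1/2 * cmod (LINT y|lborel. D y - E y - G y)"
    by simp
  also have "cmod (LINT y|lborel. D y - E y - G y) \<le> (LINT y|lborel. cmod (D y - E y - G y))"
    by (rule integral_norm_bound)
  also have "\<dots> \<le> (LINT y|lborel. 2 * M1 * k * (k / (y\<^sup>2 + k\<^sup>2)) + (M2 + 2 * M0) * k * (1 / (y\<^sup>2 + 1\<^sup>2)))"
  proof (rule integral_mono_AE)
    show "integrable lborel (\<lambda>y. 2 * M1 * k * (k / (y\<^sup>2 + k\<^sup>2)) + (M2 + 2 * M0) * k * (1 / (y\<^sup>2 + 1\<^sup>2)))"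
      by (intro Bochner_Integration.integrable_add integrable_mult_right Poisson_kernel k) auto
    have "AE y in lborel. y \<noteq> (0::real)" by (rule AE_lborel_singleton)
    then show "AE y in lborel. cmod (D y - E y - G y) \<le> 2 * M1 * k * (k / (y\<^sup>2 + k\<^sup>2)) + (M2 + 2 * M0) * k * (1 / (y\<^sup>2 + 1\<^sup>2))"
      by eventually_elim (rule bound)
  qed (use int in auto)
  also have "\<dots> = 2 * M1 * k * pi + (M2 + 2 * M0) * k * pi"
  proof -
    have "(LINT y|lborel. 2 * M1 * k * (k / (y\<^sup>2 + k\<^sup>2)) + (M2 + 2 * M0) * k * (1 / (y\<^sup>2 + 1\<^sup>2)))
       = (LINT y|lborel. 2 * M1 * k * (k / (y\<^sup>2 + k\<^sup>2))) + (LINT y|lborel. (M2 + 2 * M0) * k * (1 / (y\<^sup>2 + 1\<^sup>2)))"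
      by (intro Bochner_Integration.integral_add integrable_mult_right Poisson_kernel k) auto
    then show ?thesis by (simp only: integral_mult_right_zero Poisson_kernel[OF k] Poisson_kernel[OF zero_less_one])
  qed
  finally show ?thesis by (simp add: algebra_simps)
qed

text \<open>The direct estimate is \<open>mass / k\<close>. Going through the boundary value instead
  makes the bound uniform up to the real axis.\<close>

lemma cauchy_le:
  assumes k: "0 < k" "k \<le> 1"
  shows "cmod (cauchy (Complex l k)) \<le> 2 * M1 + mass + pi * M0 + pi * (M1 + M2 / 2 + M0)"
proof -
  have "cauchy (Complex l k) = (cauchy (Complex l k) - hilbert l - \<i> * pi * psi l) + (of_real (hilbert l) + \<i> * pi * psi l)"
    by simp
  then have "cmod (cauchy (Complex l k)) \<le> cmod (cauchy (Complex l k) - hilbert l - \<i> * pi * psi l)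
      + (cmod (of_real (hilbert l)) + cmod (\<i> * pi * psi l))"
    by (metis norm_triangle_le norm_triangle_ineq order_refl add_left_mono)
  also have "\<dots> \<le> pi * (M1 + M2 / 2 + M0) + ((2 * M1 + mass) + pi * M0)"
  proof (intro add_mono)
    have "pi * (M1 + M2 / 2 + M0) * k \<le> pi * (M1 + M2 / 2 + M0) * 1"
      using k M_nonneg by (intro mult_left_mono) auto
    then show "cmod (cauchy (Complex l k) - hilbert l - \<i> * pi * psi l) \<le> pi * (M1 + M2 / 2 + M0)"
      using cauchy_boundary[OF k(1), of l] by (simp only: mult_1_right)
  qed (use hilbert_le[of l] nonneg[of l] bounded[of l] in \<open>auto simp: norm_mult\<close>)
  finally show ?thesis by simp
qed

text \<open>The hole is symmetric about \<open>l\<close> and so survives folding. The folded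
  integrand is absolutely integrable, and the hole can be closed by dominated convergence.\<close>

lemma pv_psi: "((\<lambda>\<epsilon>. LINT x:{x. \<epsilon> \<le> \<bar>x - l\<bar>}|lborel. psi x / (x - l)) \<longlongrightarrow> hilbert l) (at_right 0)"
proof -
  have eq: "(LINT x:{x. \<epsilon> \<le> \<bar>x - l\<bar>}|lborel. psi x / (x - l)) =
      1/2 * (LINT y:{y. \<epsilon> \<le> \<bar>y - 0\<bar>}|lborel. (psi (l + y) - psi (l - y)) / y)" if e: "0 < \<epsilon>" for \<epsilon>
  proof -
    define h where "h x = indicator {x. \<epsilon> \<le> \<bar>x - l\<bar>} x *\<^sub>R (psi x / (x - l))" for x
    have "integrable lborel h"
    proof (rule Bochner_Integration.integrable_bound)
      show "integrable lborel (\<lambda>x. psi x / \<epsilon>)" using integrable by simp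
      show "h \<in> borel_measurable lborel" unfolding h_def by measurable
      show "AE x in lborel. norm (h x) \<le> norm (psi x / \<epsilon>)"
        using e nonneg by (auto intro!: AE_I2 simp: h_def indicator_def divide_left_mono mult_pos_pos)
    qed
    from lborel_integral_fold(2)[OF this, of l]
    have "(LINT x|lborel. h x) = 1/2 * (LINT y|lborel. h (l + y) + h (l - y))" by simp
    also have "(\<lambda>y. h (l + y) + h (l - y)) = (\<lambda>y. indicator {y. \<epsilon> \<le> \<bar>y - 0\<bar>} y *\<^sub>R ((psi (l + y) - psi (l - y)) / y))"
      by (auto simp: h_def indicator_def fun_eq_iff diff_divide_distrib)
    finally show ?thesis by (simp add: h_def set_lebesgue_integral_def)
  qed
  have "((\<lambda>\<epsilon>. 1/2 * (LINT y:{y. \<epsilon> \<le> \<bar>y - 0\<bar>}|lborel. (psi (l + y) - psi (l - y)) / y)) \<longlongrightarrow> hilbert l) (at_right 0)"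
    using tendsto_mult[OF tendsto_const[of "1/2"] set_integral_hole_tendsto[OF integrable_odd_part[of l], of 0]]
    by (simp add: hilbert_def)
  then show ?thesis
    by (rule Lim_transform_eventually) (auto simp: eventually_at_filter eq intro!: always_eventually)
qed

end

section \<open>Regularity of the eigenfunction\<close>

lemma vector_derivative_bound:
  fixes g :: "real \<Rightarrow> 'a::real_normed_vector"
  assumes "\<And>x. x \<in> closed_segment a b \<Longrightarrow> (g has_vector_derivative g' x) (at x)"
    and "\<And>x. x \<in> closed_segment a b \<Longrightarrow> norm (g' x) \<le> C"
  shows "norm (g a - g b) \<le> C * \<bar>a - b\<bar>"
proof -
  have "norm (g a - g b) \<le> C * norm (a - b)"
  proof (rule differentiable_bound[where S="closed_segment a b" and f'="\<lambda>x h. h *\<^sub>R g' x"])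
    fix x assume x: "x \<in> closed_segment a b"
    show "(g has_derivative (\<lambda>h. h *\<^sub>R g' x)) (at x within closed_segment a b)"
      using assms(1)[OF x] by (auto simp: has_vector_derivative_def intro: has_derivative_at_withinI)
    show "onorm (\<lambda>h. h *\<^sub>R g' x) \<le> C"
      using assms(2)[OF x] order_trans[OF norm_ge_zero assms(2)[OF x]]
      by (intro onorm_le) (simp add: mult.commute[of C] mult_left_mono)
  qed auto
  then show ?thesis by simp
qed

text \<open>The mean value inequality is used twice: for g', and then for \<open>q\<close>, whose
  derivative g'(a + t) - g'(a - t) is at most 2 C |t|.\<close>

lemma second_difference_bound:
  fixes g :: "real \<Rightarrow> 'a::real_normed_vector"
  assumes g: "\<And>x. (g has_vector_derivative g' x) (at x)" "\<And>x. (g' has_vector_derivative g'' x) (at x)"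
    and C: "\<And>x. norm (g'' x) \<le> C"
  shows "norm (g (a + h) + g (a - h) - 2 *\<^sub>R g a) \<le> 2 * C * h\<^sup>2"
proof -
  define q where "q t = g (a + t) + g (a - t) - 2 *\<^sub>R g a" for t
  have q': "(q has_vector_derivative g' (a + t) - g' (a - t)) (at t)" for t
  proof -
    have "((\<lambda>t. a + t) has_vector_derivative 1) (at t)" "((\<lambda>t. a - t) has_vector_derivative - 1) (at t)"
      by (auto intro!: derivative_eq_intros)
    from vector_diff_chain_at[OF this(1) g(1)] vector_diff_chain_at[OF this(2) g(1)]
    have "((\<lambda>t. g (a + t)) has_vector_derivative g' (a + t)) (at t)"
      "((\<lambda>t. g (a - t)) has_vector_derivative - g' (a - t)) (at t)"
      by (simp_all add: o_def)
    then show ?thesis unfolding q_def[abs_def] by (auto intro!: derivative_eq_intros)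
  qed
  have "norm (q h - q 0) \<le> (2 * C * \<bar>h\<bar>) * \<bar>h - 0\<bar>"
  proof (rule vector_derivative_bound[OF q'])
    fix t assume "t \<in> closed_segment h 0"
    then have t: "\<bar>t\<bar> \<le> \<bar>h\<bar>" by (auto simp: closed_segment_eq_real_ivl split: if_splits)
    have "norm (g' (a + t) - g' (a - t)) \<le> C * \<bar>(a + t) - (a - t)\<bar>"
      by (rule vector_derivative_bound[OF g(2) C])
    also have "\<dots> = 2 * C * \<bar>t\<bar>" by (simp add: abs_mult)
    also have "\<dots> \<le> 2 * C * \<bar>h\<bar>" using t order_trans[OF norm_ge_zero C[of 0]] by (intro mult_left_mono) auto
    finally show "norm (g' (a + t) - g' (a - t)) \<le> 2 * C * \<bar>h\<bar>" .
  qed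
  moreover have "q 0 = 0" by (simp add: q_def scaleR_2)
  ultimately show ?thesis by (simp add: q_def power2_eq_square abs_mult mult_ac)
qed

text \<open>Hadamard's lemma. It removes the division by x - x0: bounds for differences of u' pass
  to phi under the integral, with no special treatment of x0.\<close>

lemma schwartz_phi_integral:
  assumes D: "D 0 = u" "\<And>n x. (D n has_vector_derivative D (Suc n) x) (at x)" and x0: "u x0 = 0"
  shows "((\<lambda>s. D 1 (x0 + s * (x - x0))) has_integral phi u x0 x) {0..1}"
proof (cases "x = x0")
  case True
  have "vector_derivative u (at x0) = D 1 x0"
    using D(2)[of 0 x0] D(1) by (simp add: vector_derivative_at)
  then show ?thesis using True has_integral_const_real[of "D 1 x0" 0 1] by (simp add: phi_def)
next
  case False
  have "((\<lambda>s. u (x0 + s * (x - x0))) has_vector_derivative (x - x0) *\<^sub>R D 1 (x0 + s * (x - x0))) (at s)" for s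
  proof -
    have "((\<lambda>s. x0 + s * (x - x0)) has_vector_derivative (x - x0)) (at s)"
      by (auto intro!: derivative_eq_intros simp: has_real_derivative_iff_has_vector_derivative[symmetric])
    from vector_diff_chain_at[OF this D(2)[of 0]] show ?thesis by (simp add: D(1) o_def)
  qed
  then have "((\<lambda>s. (x - x0) *\<^sub>R D 1 (x0 + s * (x - x0))) has_integral u (x0 + 1 * (x - x0)) - u (x0 + 0 * (x - x0))) {0..1}"
    by (intro fundamental_theorem_of_calculus) (auto intro: has_vector_derivative_at_within)
  moreover have "phi u x0 x = (1 / (x - x0)) *\<^sub>R u x"
    using False by (simp add: phi_def scaleR_conv_of_real)
  ultimately show ?thesis
    using has_integral_cmul[of _ "u x" "{0..1}" "1 / (x - x0)"] False x0 by fastforce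
qed

text \<open>A discrete Leibniz rule: expanding around \<open>c\<close>, the second difference of the
  squared modulus is |a - c|^2 + |b - c|^2 + 2 Re((a + b - 2c) cnj c).\<close>

lemma norm_square_second_difference:
  fixes a b c :: complex
  shows "\<bar>(cmod a)\<^sup>2 + (cmod b)\<^sup>2 - 2 * (cmod c)\<^sup>2\<bar>
    \<le> (cmod (a - c))\<^sup>2 + (cmod (b - c))\<^sup>2 + 2 * (cmod (a + b - 2 *\<^sub>R c) * cmod c)"
proof -
  have "(cmod a)\<^sup>2 + (cmod b)\<^sup>2 - 2 * (cmod c)\<^sup>2 =
      (cmod (a - c))\<^sup>2 + (cmod (b - c))\<^sup>2 + 2 * Re ((a + b - 2 *\<^sub>R c) * cnj c)"
    unfolding cmod_power2 by (simp add: power2_eq_square algebra_simps)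
  moreover have "\<bar>Re ((a + b - 2 *\<^sub>R c) * cnj c)\<bar> \<le> cmod (a + b - 2 *\<^sub>R c) * cmod c"
    using abs_Re_le_cmod[of "(a + b - 2 *\<^sub>R c) * cnj c"] by (simp add: norm_mult)
  ultimately show ?thesis
    using zero_le_power2[of "cmod (a - c)"] zero_le_power2[of "cmod (b - c)"] by linarith
qed

lemma schwartz_phi:
  assumes u: "schwartz u" "sq_integrable u" "u x0 = 0"
  shows "sq_integrable (phi u x0)" "\<exists>M0 M1 M2. smooth_density (\<lambda>x. (cmod (phi u x0 x))\<^sup>2) M0 M1 M2"
proof -
  obtain D where D: "D 0 = u" "\<And>n x. (D n has_vector_derivative D (Suc n) x) (at x)"
    and bdd: "\<And>k n. bounded (range (\<lambda>x. x ^ k *\<^sub>R D n x))"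
    using u(1) unfolding schwartz_def by blast
  have "\<exists>B. \<forall>x. cmod (D n x) \<le> B" for n
    using bdd[of 0 n] by (auto simp: bounded_iff)
  then obtain B where B: "\<And>n x. cmod (D n x) \<le> B n" by metis
  have B0: "0 \<le> B n" for n using order_trans[OF norm_ge_zero B] .
  define f where "f = phi u x0"
  note I = schwartz_phi_integral[OF D u(3), folded f_def]
  have f_le: "cmod (f x) \<le> B 1" for x
    using has_integral_bound_real[OF B0 finite.emptyI I[of x]] B by simp
  have f_Lip: "cmod (f x - f y) \<le> B 2 * \<bar>x - y\<bar>" for x y
  proof -
    have "cmod (f x - f y) \<le> (B 2 * \<bar>x - y\<bar>) * measure lborel {0..1::real}"
    proof (rule has_integral_bound_real[OF _ finite.emptyI has_integral_diff[OF I I]])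
      fix s :: real assume "s \<in> {0..1} - {}"
      then have s: "0 \<le> s" "s \<le> 1" by auto
      have "cmod (D 1 (x0 + s * (x - x0)) - D 1 (x0 + s * (y - x0))) \<le> B 2 * \<bar>(x0 + s * (x - x0)) - (x0 + s * (y - x0))\<bar>"
        by (rule vector_derivative_bound) (use D(2)[of 1] B[of 2] in \<open>auto simp: numeral_2_eq_2\<close>)
      also have "\<bar>(x0 + s * (x - x0)) - (x0 + s * (y - x0))\<bar> = s * \<bar>x - y\<bar>"
      proof -
        have "(x0 + s * (x - x0)) - (x0 + s * (y - x0)) = s * (x - y)" by (simp add: algebra_simps)
        then show ?thesis using s by (simp only: abs_mult abs_of_nonneg)
      qed
      also have "\<dots> \<le> \<bar>x - y\<bar>" using s by (simp add: mult_left_le_one_le)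
      finally show "cmod (D 1 (x0 + s * (x - x0)) - D 1 (x0 + s * (y - x0))) \<le> B 2 * \<bar>x - y\<bar>"
        using B0[of 2] by (simp add: mult_left_mono)
    qed (use B0[of 2] in simp)
    then show ?thesis by simp
  qed
  have f_diff2: "cmod (f (x + y) + f (x - y) - 2 *\<^sub>R f x) \<le> 2 * B 3 * y\<^sup>2" for x y
  proof -
    have "cmod (f (x + y) + f (x - y) - 2 *\<^sub>R f x) \<le> (2 * B 3 * y\<^sup>2) * measure lborel {0..1::real}"
    proof (rule has_integral_bound_real[OF _ finite.emptyI has_integral_diff[OF has_integral_add[OF I I] has_integral_cmul[OF I]]])
      fix s :: real assume "s \<in> {0..1} - {}"
      then have s: "0 \<le> s" "s \<le> 1" by auto
      define a where "a = x0 + s * (x - x0)"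
      have "cmod (D 1 (a + s * y) + D 1 (a - s * y) - 2 *\<^sub>R D 1 a) \<le> 2 * B 3 * (s * y)\<^sup>2"
        by (rule second_difference_bound[of "D 1" "D 2" "D 3"])
           (use D(2)[of 1] D(2)[of 2] B[of 3] in \<open>auto simp: numeral_2_eq_2 numeral_3_eq_3\<close>)
      also have "\<dots> \<le> 2 * B 3 * y\<^sup>2"
        using s B0[of 3] by (intro mult_left_mono) (auto simp: power_mult_distrib power_le_one mult_left_le_one_le)
      finally show "cmod (D 1 (x0 + s * (x + y - x0)) + D 1 (x0 + s * (x - y - x0)) - 2 *\<^sub>R D 1 (x0 + s * (x - x0))) \<le> 2 * B 3 * y\<^sup>2"
        by (simp add: a_def algebra_simps)
    qed (use B0[of 3] in simp)
    then show ?thesis by simp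
  qed
  have "continuous_on UNIV f"
  proof (rule lipschitz_on_continuous_on[of "B 2"])
    show "(B 2)-lipschitz_on UNIV f"
      using B0[of 2] f_Lip by (intro lipschitz_onI) (auto simp: dist_norm)
  qed
  then have f_meas [measurable]: "f \<in> borel_measurable borel" by (rule borel_measurable_continuous_onI)
  \<comment> \<open>Within distance 1 of x0 the sup bound for phi is used; farther out |phi| <= |u|,
    since the denominator exceeds 1.\<close>
  have f_int: "integrable lborel (\<lambda>x. (cmod (f x))\<^sup>2)"
  proof (rule Bochner_Integration.integrable_bound)
    show "integrable lborel (\<lambda>x. (B 1)\<^sup>2 * indicator {x0 - 1..x0 + 1} x + (cmod (u x))\<^sup>2)"
      using u(2) by (intro Bochner_Integration.integrable_add integrable_mult_right) (auto simp: sq_integrable_def)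
    show "AE x in lborel. norm ((cmod (f x))\<^sup>2) \<le> norm ((B 1)\<^sup>2 * indicator {x0 - 1..x0 + 1} x + (cmod (u x))\<^sup>2)"
    proof (intro AE_I2)
      fix x
      have "(cmod (f x))\<^sup>2 \<le> (B 1)\<^sup>2 * indicator {x0 - 1..x0 + 1} x + (cmod (u x))\<^sup>2"
      proof (cases "x \<in> {x0 - 1..x0 + 1}")
        case True
        then show ?thesis using power_mono[OF f_le[of x] norm_ge_zero, of 2] by (simp add: add_increasing2)
      next
        case False
        then have "1 < \<bar>x - x0\<bar>" by auto
        then have "cmod (u x) / \<bar>x - x0\<bar> \<le> cmod (u x) / 1" by (intro divide_left_mono) auto
        moreover have "cmod (f x) = cmod (u x) / \<bar>x - x0\<bar>"
          using False by (auto simp: f_def phi_def norm_divide simp flip: of_real_diff)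
        ultimately show ?thesis using False by (simp add: power_mono)
      qed
      then show "norm ((cmod (f x))\<^sup>2) \<le> norm ((B 1)\<^sup>2 * indicator {x0 - 1..x0 + 1} x + (cmod (u x))\<^sup>2)"
        by simp
    qed
  qed measurable
  then show "sq_integrable (phi u x0)" by (simp add: sq_integrable_def f_def[symmetric])
  have "smooth_density (\<lambda>x. (cmod (f x))\<^sup>2) ((B 1)\<^sup>2) (2 * B 1 * B 2) (2 * (B 2)\<^sup>2 + 4 * B 3 * B 1)"
  proof
    fix x y
    show "(cmod (f x))\<^sup>2 \<le> (B 1)\<^sup>2" by (rule power_mono[OF f_le norm_ge_zero])
    have "\<bar>(cmod (f x))\<^sup>2 - (cmod (f y))\<^sup>2\<bar> = \<bar>cmod (f x) - cmod (f y)\<bar> * (cmod (f x) + cmod (f y))"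
      by (simp add: power2_eq_square square_diff_square_factored abs_mult mult.commute)
    also have "\<dots> \<le> (B 2 * \<bar>x - y\<bar>) * (B 1 + B 1)"
      using f_le[of x] f_le[of y] f_Lip[of x y] norm_triangle_ineq3[of "f x" "f y"] B0
      by (intro mult_mono) auto
    finally show "\<bar>(cmod (f x))\<^sup>2 - (cmod (f y))\<^sup>2\<bar> \<le> 2 * B 1 * B 2 * \<bar>x - y\<bar>" by (simp add: mult_ac)
    have "\<bar>(cmod (f (x + y)))\<^sup>2 + (cmod (f (x - y)))\<^sup>2 - 2 * (cmod (f x))\<^sup>2\<bar> \<le>
        (cmod (f (x + y) - f x))\<^sup>2 + (cmod (f (x - y) - f x))\<^sup>2 + 2 * (cmod (f (x + y) + f (x - y) - 2 *\<^sub>R f x) * cmod (f x))"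
      by (rule norm_square_second_difference)
    also have "\<dots> \<le> (B 2 * \<bar>y\<bar>)\<^sup>2 + (B 2 * \<bar>y\<bar>)\<^sup>2 + 2 * (2 * B 3 * y\<^sup>2 * B 1)"
      using f_Lip[of "x + y" x] f_Lip[of "x - y" x] f_diff2[of x y] f_le[of x] B0
      by (intro add_mono power_mono mult_left_mono mult_mono) auto
    finally show "\<bar>(cmod (f (x + y)))\<^sup>2 + (cmod (f (x - y)))\<^sup>2 - 2 * (cmod (f x))\<^sup>2\<bar> \<le> (2 * (B 2)\<^sup>2 + 4 * B 3 * B 1) * y\<^sup>2"
      by (simp add: power_mult_distrib algebra_simps)
  qed (use f_int in auto)
  then show "\<exists>M0 M1 M2. smooth_density (\<lambda>x. (cmod (phi u x0 x))\<^sup>2) M0 M1 M2" by (auto simp: f_def)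
qed

section \<open>The resonance\<close>

text \<open>\<open>p\<close> is the eigenfunction phi and \<open>x0\<close> the eigenvalue. The
  factorisation retains all that is needed of phi: it reduces every integral involving
  \<open>u\<close> to the Cauchy integral of |p|^2.\<close>

locale resonance = smooth_density "\<lambda>x. (cmod (p x))\<^sup>2" M0 M1 M2
  for p :: "real \<Rightarrow> complex" and M0 M1 M2 +
  fixes u :: "real \<Rightarrow> complex" and x0 :: real
  assumes u: "sq_integrable u" and p: "sq_integrable p"
    and factor: "\<And>x. u x = of_real (x - x0) * p x"
begin

text \<open>Equal to the integral of |u|^2 / (x - x0), the principal value at the unperturbed
  eigenvalue; compare \<open>pv_u\<close> at \<open>l = x0\<close>.\<close>

definition "moment = (LINT x|lborel. (x - x0) * (cmod (p x))\<^sup>2)"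

text \<open>With \<open>A = cauchy z\<close>, these are \<open>B = \<integral>(x - x\<^sub>0)|p|\<^sup>2/(x - z)\<close> and \<open>1 + a \<integral>|u|\<^sup>2/(x - z)\<close>.\<close>

definition B :: "complex \<Rightarrow> complex" where "B z = mass + (z - of_real x0) * cauchy z"
definition F :: "real \<Rightarrow> complex \<Rightarrow> complex" where "F a z = 1 + of_real a * (moment + (z - of_real x0) * B z)"

lemma integrable_moment: "integrable lborel (\<lambda>x. (x - x0) * (cmod (p x))\<^sup>2)"
proof -
  have "u x * cnj (p x) = complex_of_real ((x - x0) * (cmod (p x))\<^sup>2)" for x
    using complex_norm_square[of "p x"] by (simp add: factor mult.assoc)
  then show ?thesis
    using integrable_Re[OF sq_integrable_mult_cnj[OF u p]] by simp
qed

lemma mass_norm: "(norm (L2_of p))\<^sup>2 = mass"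
  by (simp add: norm_L2_of[OF p] mass_def)

text \<open>Division by x - l: (x - x0)^2 = (x - l) ((x - x0) + (l - x0)) + (l - x0)^2. The singular
  integral thus appears only with the factor (l - x0)^2.\<close>

lemma pv_u: "pv (\<lambda>x. (cmod (u x))\<^sup>2) l = moment + (l - x0) * mass + (l - x0)\<^sup>2 * hilbert l"
proof -
  define h where "h x = (x - x0) * (cmod (p x))\<^sup>2 + (l - x0) * (cmod (p x))\<^sup>2" for x
  have h: "integrable lborel h" "(LINT x|lborel. h x) = moment + (l - x0) * mass"
    unfolding h_def using integrable_moment integrable by (simp_all add: moment_def mass_def)
  have "(LINT x:{x. \<epsilon> \<le> \<bar>x - l\<bar>}|lborel. (cmod (u x))\<^sup>2 / of_real (x - l)) =
      (LINT x:{x. \<epsilon> \<le> \<bar>x - l\<bar>}|lborel. h x) + (l - x0)\<^sup>2 * (LINT x:{x. \<epsilon> \<le> \<bar>x - l\<bar>}|lborel. (cmod (p x))\<^sup>2 / (x - l))"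
    if e: "0 < \<epsilon>" for \<epsilon>
  proof -
    have S: "{x. \<epsilon> \<le> \<bar>x - l\<bar>} \<in> sets lborel" by measurable
    have int: "set_integrable lborel {x. \<epsilon> \<le> \<bar>x - l\<bar>} (\<lambda>x. (cmod (p x))\<^sup>2 / (x - l))"
      unfolding set_integrable_def
    proof (rule Bochner_Integration.integrable_bound)
      show "integrable lborel (\<lambda>x. (cmod (p x))\<^sup>2 / \<epsilon>)" using integrable by simp
      show "AE x in lborel. norm (indicator {x. \<epsilon> \<le> \<bar>x - l\<bar>} x *\<^sub>R ((cmod (p x))\<^sup>2 / (x - l))) \<le> norm ((cmod (p x))\<^sup>2 / \<epsilon>)"
        using e by (auto intro!: AE_I2 simp: indicator_def divide_left_mono mult_pos_pos)
    qed measurable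
    have "(LINT x:{x. \<epsilon> \<le> \<bar>x - l\<bar>}|lborel. (cmod (u x))\<^sup>2 / of_real (x - l)) =
        (LINT x:{x. \<epsilon> \<le> \<bar>x - l\<bar>}|lborel. h x + (l - x0)\<^sup>2 * ((cmod (p x))\<^sup>2 / (x - l)))"
    proof (rule set_lebesgue_integral_cong[OF S], intro allI impI)
      fix x assume "x \<in> {x. \<epsilon> \<le> \<bar>x - l\<bar>}"
      then have "x - l \<noteq> 0" using e by auto
      moreover have "(cmod (u x))\<^sup>2 = (x - x0)\<^sup>2 * (cmod (p x))\<^sup>2"
        by (simp only: factor norm_mult norm_of_real power_mult_distrib power2_abs)
      ultimately show "(cmod (u x))\<^sup>2 / of_real (x - l) = h x + (l - x0)\<^sup>2 * ((cmod (p x))\<^sup>2 / (x - l))"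
        by (simp add: h_def field_simps power2_eq_square)
    qed
    also have "\<dots> = (LINT x:{x. \<epsilon> \<le> \<bar>x - l\<bar>}|lborel. h x) + (LINT x:{x. \<epsilon> \<le> \<bar>x - l\<bar>}|lborel. (l - x0)\<^sup>2 * ((cmod (p x))\<^sup>2 / (x - l)))"
    proof (rule set_integral_add(2)[OF _ set_integrable_mult_right[OF int]])
      show "set_integrable lborel {x. \<epsilon> \<le> \<bar>x - l\<bar>} h"
        unfolding set_integrable_def by (rule integrable_mult_indicator[OF S h(1)])
    qed
    finally show ?thesis by (simp only: set_integral_mult_right)
  qed
  moreover have "((\<lambda>\<epsilon>. (LINT x:{x. \<epsilon> \<le> \<bar>x - l\<bar>}|lborel. h x) + (l - x0)\<^sup>2 * (LINT x:{x. \<epsilon> \<le> \<bar>x - l\<bar>}|lborel. (cmod (p x))\<^sup>2 / (x - l)))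
      \<longlongrightarrow> moment + (l - x0) * mass + (l - x0)\<^sup>2 * hilbert l) (at_right 0)"
    using set_integral_hole_tendsto[OF h(1), of l] by (intro tendsto_intros pv_psi) (simp add: h(2))
  ultimately have "((\<lambda>\<epsilon>. LINT x:{x. \<epsilon> \<le> \<bar>x - l\<bar>}|lborel. (cmod (u x))\<^sup>2 / of_real (x - l))
      \<longlongrightarrow> moment + (l - x0) * mass + (l - x0)\<^sup>2 * hilbert l) (at_right 0)"
    by (elim Lim_transform_eventually) (auto simp: eventually_at_filter intro!: always_eventually)
  then show ?thesis unfolding pv_def by (intro tendsto_Lim) simp_all
qed

lemma sq_integrable_divide:
  fixes z :: complex
  assumes "sq_integrable f" "Im z \<noteq> 0"
  shows "sq_integrable (\<lambda>x. f x / (of_real x - z))"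
proof (rule sq_integrable_bound[OF sq_integrable_cmult[OF assms(1), of "1 / of_real (Im z)"]])
  have [measurable]: "f \<in> borel_measurable borel" by (rule sq_integrable_measurable[OF assms(1)])
  show "(\<lambda>x. f x / (of_real x - z)) \<in> borel_measurable borel" by measurable
  fix x
  have "\<bar>Im z\<bar> \<le> cmod (of_real x - z)" using abs_Im_le_cmod[of "of_real x - z"] by simp
  then show "cmod (f x / (of_real x - z)) \<le> cmod (1 / of_real (Im z) * f x)"
    using assms(2) by (auto simp: norm_divide intro!: divide_left_mono mult_pos_pos)
qed

text \<open>Each \<open>u\<close> contributes a factor x - x0, and (x - x0) / (x - z) = 1 + (z - x0)
  / (x - z). Applied once this gives \<open>B\<close>, applied twice the last entry.\<close>

lemma resolvent_matrix_elements:
  fixes z :: complex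
  assumes z: "Im z \<noteq> 0"
  defines "R f \<equiv> L2_of (\<lambda>x. f x / (of_real x - z))"
  shows "cinner (R p) (L2_of p) = cauchy z" "cinner (R u) (L2_of p) = B z"
    "cinner (R p) (L2_of u) = B z" "cinner (R u) (L2_of u) = moment + (z - x0) * B z"
proof -
  have nz: "of_real x - z \<noteq> 0" for x using z by (auto simp: complex_eq_iff)
  have p2: "p x * cnj (p x) = of_real ((cmod (p x))\<^sup>2)" for x by (simp only: complex_norm_square)
  note sq = sq_integrable_divide[OF p z] sq_integrable_divide[OF u z] p u
  have c: "integrable lborel (\<lambda>x. complex_of_real ((cmod (p x))\<^sup>2) / (complex_of_real x - z))"
    by (rule integrable_cauchy[OF z])
  have i0: "integrable lborel (\<lambda>x. complex_of_real ((cmod (p x))\<^sup>2))"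
    "(LINT x|lborel. complex_of_real ((cmod (p x))\<^sup>2)) = mass"
    using integrable_of_real[OF integrable, where 'a=complex] by (simp_all only: integral_complex_of_real mass_def)
  have i1: "integrable lborel (\<lambda>x. complex_of_real ((x - x0) * (cmod (p x))\<^sup>2))"
    "(LINT x|lborel. complex_of_real ((x - x0) * (cmod (p x))\<^sup>2)) = moment"
    using integrable_of_real[OF integrable_moment, where 'a=complex] by (simp_all only: integral_complex_of_real moment_def)
  define b where "b x = complex_of_real ((cmod (p x))\<^sup>2) + (z - x0) * (complex_of_real ((cmod (p x))\<^sup>2) / (of_real x - z))" for x
  have b: "integrable lborel b" "(LINT x|lborel. b x) = B z"
    unfolding b_def
    by (intro Bochner_Integration.integrable_add integrable_mult_right i0 c)
       (simp only: Bochner_Integration.integral_add[OF i0(1) integrable_mult_right[OF c]] i0(2)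
         integral_mult_right_zero B_def cauchy_def)
  have b': "b x = of_real (x - x0) * (of_real ((cmod (p x))\<^sup>2) / (of_real x - z))" for x
    using nz[of x] by (simp add: b_def field_simps)
  have g: "integrable lborel (\<lambda>x. complex_of_real ((x - x0) * (cmod (p x))\<^sup>2) + (z - x0) * b x)"
    "(LINT x|lborel. complex_of_real ((x - x0) * (cmod (p x))\<^sup>2) + (z - x0) * b x) = moment + (z - x0) * B z"
    by (intro Bochner_Integration.integrable_add integrable_mult_right i1 b)
       (simp only: Bochner_Integration.integral_add[OF i1(1) integrable_mult_right[OF b(1)]] i1(2) b(2)
         integral_mult_right_zero)
  have g': "complex_of_real ((x - x0) * (cmod (p x))\<^sup>2) + (z - x0) * b x = of_real (x - x0) * b x" for x
    unfolding b' using nz[of x] by (simp add: field_simps)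
  show "cinner (R p) (L2_of p) = cauchy z"
    unfolding R_def cinner_L2_of[OF sq(1,3)] cauchy_def
    by (intro Bochner_Integration.integral_cong refl) (simp only: times_divide_eq_left p2)
  show "cinner (R u) (L2_of p) = B z"
    unfolding R_def cinner_L2_of[OF sq(2,3)] b(2)[symmetric]
    by (intro Bochner_Integration.integral_cong refl) (simp only: factor b' p2[symmetric] times_divide_eq_left times_divide_eq_right complex_cnj_mult complex_cnj_complex_of_real mult_ac)
  show "cinner (R p) (L2_of u) = B z"
    unfolding R_def cinner_L2_of[OF sq(1,4)] b(2)[symmetric]
    by (intro Bochner_Integration.integral_cong refl) (simp only: factor b' p2[symmetric] times_divide_eq_left times_divide_eq_right complex_cnj_mult complex_cnj_complex_of_real mult_ac)
  show "cinner (R u) (L2_of u) = moment + (z - x0) * B z"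
    unfolding R_def cinner_L2_of[OF sq(2,4)] g(2)[symmetric]
    by (intro Bochner_Integration.integral_cong refl) (simp only: g', simp only: factor b' p2[symmetric] times_divide_eq_left times_divide_eq_right complex_cnj_mult complex_cnj_complex_of_real mult_ac)
qed

text \<open>Krein's formula for \<open>w = F (H - z)\<^sup>-\<^sup>1 p\<close>; the factor \<open>F\<close> avoids the question whether \<open>F\<close> vanishes.\<close>

lemma Krein_resolvent:
  fixes z :: complex
  assumes z: "Im z \<noteq> 0"
  obtains w w' where "H_op (L2_of u) a w = Some w'" "w' - cscale z w = cscale (F a z) (L2_of p)"
    "cinner w (L2_of p) = F a z * cauchy z - of_real a * (B z)\<^sup>2"
proof
  \<comment> \<open>With this coefficient <w, u> = F B - c (moment + (z - x0) B) = B by the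
    definition of \<open>F\<close>. The rank-one term a <w, u> u of the operator then cancels the
    term -c u left over by multiplication with x.\<close>
  define c where "c = of_real a * B z"
  define R where "R f = L2_of (\<lambda>x. f x / (of_real x - z))" for f
  note el = resolvent_matrix_elements[OF z, folded R_def]
  have nz: "of_real x - z \<noteq> 0" for x using z by (auto simp: complex_eq_iff)
  define g where "g x = F a z * (p x / (of_real x - z)) - c * (u x / (of_real x - z))" for x
  note sq = sq_integrable_cmult[OF sq_integrable_divide[OF p z]] sq_integrable_cmult[OF sq_integrable_divide[OF u z]]
  have g: "sq_integrable g" unfolding g_def by (intro sq_integrable_diff sq)
  define w where "w = L2_of g"
  have w: "w = cscale (F a z) (R p) - cscale c (R u)"
    unfolding w_def g_def[abs_def] R_def L2_of_diff[OF sq]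
    by (simp only: L2_of_cscale[OF sq_integrable_divide[OF p z]] L2_of_cscale[OF sq_integrable_divide[OF u z]])
  have xg: "(\<lambda>x. of_real x * g x) = (\<lambda>x. z * g x + (F a z * p x - c * u x))"
  proof
    fix x
    have "(of_real x - z) * g x = F a z * p x - c * u x" using nz[of x] by (simp add: g_def right_diff_distrib)
    then show "of_real x * g x = z * g x + (F a z * p x - c * u x)" by (simp add: algebra_simps)
  qed
  have xg_sq: "sq_integrable (\<lambda>x. of_real x * g x)"
    unfolding xg by (intro sq_integrable_add sq_integrable_diff sq_integrable_cmult g p u)
  have "mult_x w = Some (L2_of (\<lambda>x. of_real x * g x))"
    unfolding w_def by (rule mult_x_L2_of[OF g xg_sq])
  also have "L2_of (\<lambda>x. of_real x * g x) = cscale z w + (cscale (F a z) (L2_of p) - cscale c (L2_of u))"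
    unfolding xg w_def by (simp only: L2_of_add L2_of_diff L2_of_cscale sq_integrable_diff sq_integrable_cmult g p u)
  finally have mult: "mult_x w = Some (cscale z w + (cscale (F a z) (L2_of p) - cscale c (L2_of u)))" .
  have "cinner w (L2_of u) = B z"
    by (simp add: w cinner.diff_left cinner_cscale_left el c_def F_def algebra_simps)
  then show "H_op (L2_of u) a w = Some (cscale z w + cscale (F a z) (L2_of p))"
    by (simp add: H_op_def mult c_def)
  show "cscale z w + cscale (F a z) (L2_of p) - cscale z w = cscale (F a z) (L2_of p)" by simp
  show "cinner w (L2_of p) = F a z * cauchy z - of_real a * (B z)\<^sup>2"
    by (simp add: w cinner.diff_left cinner_cscale_left el c_def power2_eq_square)
qed

text \<open>The bound of \<open>cauchy_le\<close>. Its last summand is the constant of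
  \<open>cauchy_boundary\<close>, so \<open>C\<close> bounds |A| and, multiplied by k, also the
  distance of A from its boundary value.\<close>

definition "C = 2 * M1 + mass + pi * M0 + pi * (M1 + M2 / 2 + M0)"

text \<open>To leading order the negation would give mass^2 <= (2 k mass) (mass / (4 k)) = mass^2 /
  2. The factor 10 in \<open>small\<close> keeps each relative error below one tenth, which this gap
  tolerates.\<close>

lemma sojourn_time_gt:
  assumes mass: "0 < mass" and zero: "1 + a * pv (\<lambda>x. (cmod (u x))\<^sup>2) l = 0"
    and k: "k = pi * (cmod (u l))\<^sup>2 / mass" "0 < k" "k \<le> 1"
    and small: "10 * C * ((l - x0)\<^sup>2 + 2 * \<bar>l - x0\<bar> + k) \<le> mass"
  shows "ennreal (mass\<^sup>2 / (4 * k)) < sojourn_time (H_op (L2_of u) a) (L2_of p)"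
proof (rule ccontr)
  assume "\<not> ?thesis"
  then have le: "sojourn_time (H_op (L2_of u) a) (L2_of p) \<le> ennreal (mass\<^sup>2 / (4 * k))" by simp
  define z A d \<eta> where "z = Complex l k" and "A = cauchy z" and "d = l - x0" and "\<eta> = d\<^sup>2 + 2 * \<bar>d\<bar> + k"
  have a: "a \<noteq> 0" using zero by auto
  have C0: "0 \<le> C" using M_nonneg mass by (simp add: C_def)
  have A: "cmod A \<le> C" unfolding A_def z_def C_def by (rule cauchy_le[OF k(2,3)])
  have Im: "Im z = k" by (simp add: z_def)
  obtain w w' where w: "H_op (L2_of u) a w = Some w'" "w' - cscale z w = cscale (F a z) (L2_of p)"
    "cinner w (L2_of p) = F a z * A - of_real a * (B z)\<^sup>2"
    using Krein_resolvent[of z a] k(2) Im unfolding A_def by auto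
  \<comment> \<open>The parameter \<open>s = mass / 2\<close> minimises
    \<open>s / (4 * k) + T / (4 * s)\<close> for \<open>T = mass\<^sup>2 / (4 * k)\<close>: both
    summands become mass / (8 k).\<close>
  have "cmod (cinner w (L2_of p)) \<le> cmod (F a z) * (mass / 2 / (4 * k) + mass\<^sup>2 / (4 * k) / (4 * (mass / 2)))"
    using mass k(2) le w
    by (intro resolvent_le_sojourn_time[OF exp_group_H_op(1)[of "L2_of u" a]])
       (auto simp: exp_group_H_op(2) Im sojourn_time_def)
  also have "mass / 2 / (4 * k) + mass\<^sup>2 / (4 * k) / (4 * (mass / 2)) = mass / (4 * k)"
    using mass k(2) by (simp add: field_simps power2_eq_square)
  finally have res: "cmod (F a z * A - of_real a * (B z)\<^sup>2) \<le> cmod (F a z) * (mass / (4 * k))"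
    by (simp add: w(3))
  define e where "e = A - hilbert l - \<i> * pi * (cmod (p l))\<^sup>2"
  have e: "cmod e \<le> C * k"
  proof -
    have "pi * (M1 + M2 / 2 + M0) * k \<le> C * k"
      unfolding C_def using M_nonneg mass k(2) by (intro mult_right_mono) auto
    then show ?thesis using cauchy_boundary[OF k(2), of l] by (simp add: e_def A_def z_def)
  qed
  \<comment> \<open>The definition of \<open>k\<close>, read through the factorisation at
    \<open>l\<close>; it converts the boundary value of the imaginary part into
    \<open>k * mass\<close>.\<close>
  have kd: "k * mass = d\<^sup>2 * (pi * (cmod (p l))\<^sup>2)"
    using mass by (simp add: k(1) factor norm_mult power_mult_distrib d_def flip: of_real_diff)
  have z: "z - x0 = d + \<i> * k" by (simp add: z_def d_def complex_eq_iff)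
  \<comment> \<open>The hypothesis \<open>zero\<close> removes the real leading part. The term
    \<open>k * mass\<close> arises twice: from d^2 times the boundary value of A, by
    \<open>kd\<close>, and from the shift i k in (z - x0) mass.\<close>
  have F: "F a z = a * (2 * \<i> * (k * mass) + (d\<^sup>2 * e + (2 * \<i> * d * k - k\<^sup>2) * A))"
  proof -
    have "complex_of_real (1 + a * (moment + d * mass + d\<^sup>2 * hilbert l)) = 0"
      using zero by (simp only: pv_u d_def of_real_0)
    then have zero': "1 + of_real a * (moment + d * mass + d\<^sup>2 * hilbert l) = (0::complex)" by simp
    have "F a z = (1 + of_real a * (moment + d * mass + d\<^sup>2 * hilbert l)) +
       a * (\<i> * (k * mass) + \<i> * (d\<^sup>2 * (pi * (cmod (p l))\<^sup>2)) + (d\<^sup>2 * e + (2 * \<i> * d * k - k\<^sup>2) * A))"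
      unfolding F_def B_def z A_def[symmetric] e_def
      by (simp add: algebra_simps power2_eq_square)
    also have "\<i> * complex_of_real (d\<^sup>2 * (pi * (cmod (p l))\<^sup>2)) = \<i> * (k * mass)"
      by (simp only: kd)
    finally show ?thesis using zero' by (simp add: algebra_simps)
  qed
  have E: "cmod (d\<^sup>2 * e + (2 * \<i> * d * k - k\<^sup>2) * A) \<le> C * \<eta> * k"
  proof -
    have "cmod (2 * \<i> * d * k - k\<^sup>2) \<le> cmod (2 * \<i> * d * k) + cmod (complex_of_real (k\<^sup>2))"
      by (metis norm_triangle_ineq4)
    also have "\<dots> = 2 * \<bar>d\<bar> * k + k\<^sup>2" using k(2) by (simp add: norm_mult norm_power)
    finally have "cmod ((2 * \<i> * d * k - k\<^sup>2) * A) \<le> (2 * \<bar>d\<bar> * k + k\<^sup>2) * C"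
      unfolding norm_mult using A k(2) by (intro mult_mono) auto
    moreover have "cmod (d\<^sup>2 * e) \<le> d\<^sup>2 * (C * k)"
      unfolding norm_mult using e by (intro mult_mono) (auto simp: norm_power)
    ultimately show ?thesis
      using norm_triangle_ineq[of "d\<^sup>2 * e" "(2 * \<i> * d * k - k\<^sup>2) * A"]
      by (simp add: \<eta>_def algebra_simps power2_eq_square)
  qed
  have F_le: "cmod (F a z) \<le> \<bar>a\<bar> * (k * (2 * mass + C * \<eta>))"
  proof -
    have "cmod (2 * \<i> * (k * mass) + (d\<^sup>2 * e + (2 * \<i> * d * k - k\<^sup>2) * A)) \<le> 2 * (k * mass) + C * \<eta> * k"
    proof (rule norm_triangle_le, rule add_mono[OF _ E])
      show "cmod (2 * \<i> * (k * mass)) \<le> 2 * (k * mass)" using k(2) mass by (simp add: norm_mult)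
    qed
    also have "2 * (k * mass) + C * \<eta> * k = k * (2 * mass + C * \<eta>)" by (simp add: algebra_simps)
    finally show ?thesis
      unfolding F norm_mult[of "of_real a"] norm_of_real by (rule mult_left_mono[OF _ abs_ge_zero])
  qed
  have \<eta>: "0 \<le> \<eta>" "k \<le> \<eta>" "C * \<eta> \<le> mass / 10" "\<bar>d\<bar> + k \<le> \<eta>"
    using k(2) small by (auto simp: \<eta>_def d_def algebra_simps)
  have B_ge: "9 / 10 * mass \<le> cmod (B z)"
  proof -
    have "cmod (z - x0) \<le> \<eta>"
      using norm_triangle_ineq[of "complex_of_real d" "\<i> * k"] k(2) \<eta>(4) by (simp add: z norm_mult)
    then have "cmod ((z - x0) * A) \<le> \<eta> * C" unfolding norm_mult using A \<eta>(1) by (intro mult_mono) auto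
    moreover have "mass \<le> cmod (B z) + cmod ((z - x0) * A)"
      using norm_triangle_ineq4[of "B z" "(z - x0) * A"] mass by (simp add: B_def A_def)
    ultimately show ?thesis using \<eta>(3) by (simp add: mult.commute)
  qed
  \<comment> \<open>\<open>B z\<close> squared is isolated, so that division by \<open>F\<close> is
    avoided. In units of mass^2 the chain ends in 0.81 <= 2.1 * 0.35 = 0.735.\<close>
  have "\<bar>a\<bar> * (9 / 10 * mass)\<^sup>2 \<le> \<bar>a\<bar> * (cmod (B z))\<^sup>2"
    using B_ge mass by (intro mult_left_mono power_mono) auto
  also have "\<dots> = cmod (F a z * A - (F a z * A - of_real a * (B z)\<^sup>2))"
    by (simp add: norm_mult norm_power)
  also have "\<dots> \<le> cmod (F a z) * cmod A + cmod (F a z) * (mass / (4 * k))"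
    using norm_triangle_ineq4[of "F a z * A" "F a z * A - of_real a * (B z)\<^sup>2"] res
    by (simp add: norm_mult)
  also have "\<dots> = cmod (F a z) * (cmod A + mass / (4 * k))" by (simp add: algebra_simps)
  also have "\<dots> \<le> (\<bar>a\<bar> * (k * (2 * mass + C * \<eta>))) * (C + mass / (4 * k))"
    using F_le A mass k(2) C0 \<eta>(1) by (intro mult_mono add_mono) auto
  also have "\<dots> = \<bar>a\<bar> * ((2 * mass + C * \<eta>) * (C * k + mass / 4))"
    using k(2) by (simp add: field_simps)
  also have "\<dots> \<le> \<bar>a\<bar> * ((2 * mass + mass / 10) * (mass / 10 + mass / 4))"
  proof -
    have "C * k \<le> mass / 10" using mult_left_mono[OF \<eta>(2) C0] \<eta>(3) by simp
    then show ?thesis using \<eta>(3) mass C0 k(2) by (intro mult_left_mono mult_mono add_mono) auto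
  qed
  finally have "(9 / 10 * mass)\<^sup>2 \<le> (2 * mass + mass / 10) * (mass / 10 + mass / 4)"
    using a by simp
  then have "3 / 40 * (mass * mass) \<le> 0" by (simp add: power2_eq_square field_simps)
  then show False using mult_pos_pos[OF mass mass] by linarith
qed

end

section \<open>Choice of the neighbourhood of the critical coupling\<close>

theorem theorem5p2:
  fixes \<alpha>\<^sub>0 \<mu>\<^sub>0 :: real and u :: "real \<Rightarrow> complex"
    and J :: "real set" and \<mu> :: "real \<Rightarrow> real"
  assumes "schwartz u"
    and "norm (L2_of u) = 1"
    and "\<And>x. u x = 0 \<longleftrightarrow> x = \<mu>\<^sub>0"
    and "1 + \<alpha>\<^sub>0 * pv (\<lambda>x. (cmod (u x))\<^sup>2) \<mu>\<^sub>0 = 0"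
    and "open J" "is_interval J" "\<alpha>\<^sub>0 \<in> J"
    and "\<mu> C1_differentiable_on J"
    and "\<mu> \<alpha>\<^sub>0 = \<mu>\<^sub>0"
    and "\<And>\<alpha>. \<alpha> \<in> J \<Longrightarrow> F1 u \<alpha> (\<mu> \<alpha>) = 0"
  shows "\<exists>\<delta>>0. {\<alpha>\<^sub>0 - \<delta> <..< \<alpha>\<^sub>0 + \<delta>} \<subseteq> J \<and>
           (\<forall>\<alpha>. 0 < \<bar>\<alpha> - \<alpha>\<^sub>0\<bar> \<and> \<bar>\<alpha> - \<alpha>\<^sub>0\<bar> < \<delta> \<longrightarrow>
              ennreal ((norm (L2_of (phi u \<mu>\<^sub>0))) ^ 4 / (4 * kappa u \<mu>\<^sub>0 \<mu> \<alpha>))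
                < sojourn_time (H_op (L2_of u) \<alpha>) (L2_of (phi u \<mu>\<^sub>0)))"
proof -
  \<comment> \<open>\<open>L2_of\<close> sends functions that are not square-integrable to 0, and
    norm 1 excludes this.\<close>
  have u: "sq_integrable u" using assms(2) by (auto simp: L2_of_def split: if_splits)
  have u0: "u \<mu>\<^sub>0 = 0" using assms(3) by simp
  obtain M0 M1 M2 where dens: "smooth_density (\<lambda>x. (cmod (phi u \<mu>\<^sub>0 x))\<^sup>2) M0 M1 M2"
    using schwartz_phi(2)[OF assms(1) u u0] by blast
  interpret smooth_density "\<lambda>x. (cmod (phi u \<mu>\<^sub>0 x))\<^sup>2" M0 M1 M2 by (rule dens)
  interpret resonance "phi u \<mu>\<^sub>0" M0 M1 M2 u \<mu>\<^sub>0
    by unfold_locales (auto simp: u schwartz_phi(1)[OF assms(1) u u0] phi_def u0)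
  have mass: "0 < mass"
  proof (rule ccontr)
    assume "\<not> 0 < mass"
    then have "L2_of (phi u \<mu>\<^sub>0) = 0" using mass_norm mass_nonneg by auto
    then have "AE x in lborel. phi u \<mu>\<^sub>0 x = 0"
      using L2_of_eqD[OF p sq_integrable_zero] by (simp add: L2_of_def zero_L2_def)
    then have "AE x in lborel. u x = 0" by eventually_elim (simp add: factor)
    then have "L2_of u = L2_of (\<lambda>x. 0)" by (intro L2_of_eqI u sq_integrable_zero)
    then show False using assms(2) by (simp add: L2_of_def zero_L2_def[symmetric])
  qed
  define c where "c = pi * M0 / mass"
  have c: "0 \<le> c" using M_nonneg mass by (simp add: c_def)
  \<comment> \<open>The quantity in the smallness condition with \<open>k\<close> replaced by its
    upper bound c d^2, which comes from |phi|^2 <= M0. In this form its continuity follows from that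
    of \<open>\<mu>\<close> alone.\<close>
  define \<eta> where "\<eta> \<alpha> = (\<mu> \<alpha> - \<mu>\<^sub>0)\<^sup>2 + 2 * \<bar>\<mu> \<alpha> - \<mu>\<^sub>0\<bar> + c * (\<mu> \<alpha> - \<mu>\<^sub>0)\<^sup>2" for \<alpha>
  have C0: "0 < C"
    using M_nonneg mass by (simp add: C_def add_pos_nonneg add_nonneg_pos)
  have "isCont \<mu> \<alpha>\<^sub>0"
    using C1_differentiable_imp_continuous_on[OF assms(8)] assms(5,7) by (simp add: continuous_on_eq_continuous_at)
  then have "isCont \<eta> \<alpha>\<^sub>0" unfolding \<eta>_def[abs_def] by (intro continuous_intros)
  moreover have "\<eta> \<alpha>\<^sub>0 = 0" by (simp add: \<eta>_def assms(9))
  ultimately have "(\<eta> \<longlongrightarrow> 0) (at \<alpha>\<^sub>0)" by (simp add: isCont_def)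
  then have "eventually (\<lambda>\<alpha>. \<eta> \<alpha> < min 1 (mass / (10 * C))) (at \<alpha>\<^sub>0)"
    using mass C0 by (intro order_tendstoD) auto
  then obtain \<delta>1 where \<delta>1: "0 < \<delta>1" "\<And>\<alpha>. \<alpha> \<noteq> \<alpha>\<^sub>0 \<Longrightarrow> \<bar>\<alpha> - \<alpha>\<^sub>0\<bar> < \<delta>1 \<Longrightarrow> \<eta> \<alpha> < min 1 (mass / (10 * C))"
    unfolding eventually_at by (auto simp: dist_real_def)
  obtain \<delta>2 where \<delta>2: "0 < \<delta>2" "ball \<alpha>\<^sub>0 \<delta>2 \<subseteq> J"
    using assms(5,7) by (auto simp: open_contains_ball)
  have J: "\<alpha> \<in> J" if "\<bar>\<alpha> - \<alpha>\<^sub>0\<bar> < \<delta>2" for \<alpha>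
    using \<delta>2(2) that by (auto simp: dist_real_def abs_minus_commute subset_iff)
  have main: "ennreal ((norm (L2_of (phi u \<mu>\<^sub>0))) ^ 4 / (4 * kappa u \<mu>\<^sub>0 \<mu> \<alpha>))
                < sojourn_time (H_op (L2_of u) \<alpha>) (L2_of (phi u \<mu>\<^sub>0))"
    if "\<alpha> \<noteq> \<alpha>\<^sub>0" "\<bar>\<alpha> - \<alpha>\<^sub>0\<bar> < \<delta>1" "\<bar>\<alpha> - \<alpha>\<^sub>0\<bar> < \<delta>2" for \<alpha>
  proof -
    define k where "k = pi * (cmod (u (\<mu> \<alpha>)))\<^sup>2 / mass"
    have zero: "1 + \<alpha> * pv (\<lambda>x. (cmod (u x))\<^sup>2) (\<mu> \<alpha>) = 0"
      using assms(10)[OF J[OF that(3)]] by (simp add: F1_def)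
    \<comment> \<open>Otherwise 1 + x * pv would vanish at the same point for two distinct values x
      of the coupling, although the principal value there is nonzero. Positivity of
      \<open>k\<close>, and with it a genuine denominator, depends on this.\<close>
    have "\<mu> \<alpha> \<noteq> \<mu>\<^sub>0"
    proof
      assume "\<mu> \<alpha> = \<mu>\<^sub>0"
      then have "\<alpha> * pv (\<lambda>x. (cmod (u x))\<^sup>2) \<mu>\<^sub>0 = \<alpha>\<^sub>0 * pv (\<lambda>x. (cmod (u x))\<^sup>2) \<mu>\<^sub>0"
        using zero[unfolded \<open>\<mu> \<alpha> = \<mu>\<^sub>0\<close>] assms(4) by linarith
      then show False using that(1) assms(4) by simp
    qed
    then have "0 < k" using assms(3) mass by (simp add: k_def)
    have "k = pi * ((\<mu> \<alpha> - \<mu>\<^sub>0)\<^sup>2 * (cmod (phi u \<mu>\<^sub>0 (\<mu> \<alpha>)))\<^sup>2) / mass"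
      unfolding k_def factor[of "\<mu> \<alpha>"] by (simp only: norm_mult norm_of_real power_mult_distrib power2_abs)
    also have "\<dots> \<le> pi * ((\<mu> \<alpha> - \<mu>\<^sub>0)\<^sup>2 * M0) / mass"
      using bounded[of "\<mu> \<alpha>"] mass by (intro divide_right_mono mult_left_mono) auto
    finally have k_le: "k \<le> c * (\<mu> \<alpha> - \<mu>\<^sub>0)\<^sup>2" by (simp add: c_def mult_ac)
    have \<eta>: "\<eta> \<alpha> < 1" "\<eta> \<alpha> < mass / (10 * C)" using \<delta>1(2)[OF that(1,2)] by auto
    have "k \<le> 1" using k_le \<eta>(1) by (simp add: \<eta>_def add.assoc) (smt (verit) zero_le_power2)
    moreover have "10 * C * ((\<mu> \<alpha> - \<mu>\<^sub>0)\<^sup>2 + 2 * \<bar>\<mu> \<alpha> - \<mu>\<^sub>0\<bar> + k) \<le> mass"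
    proof -
      have "10 * C * ((\<mu> \<alpha> - \<mu>\<^sub>0)\<^sup>2 + 2 * \<bar>\<mu> \<alpha> - \<mu>\<^sub>0\<bar> + k) \<le> 10 * C * \<eta> \<alpha>"
        using k_le C0 unfolding \<eta>_def by (intro mult_left_mono add_mono) auto
      also have "\<dots> \<le> mass" using \<eta>(2) C0 by (simp add: field_simps)
      finally show ?thesis .
    qed
    ultimately have "ennreal (mass\<^sup>2 / (4 * k)) < sojourn_time (H_op (L2_of u) \<alpha>) (L2_of (phi u \<mu>\<^sub>0))"
      using \<open>0 < k\<close> by (intro sojourn_time_gt[OF mass zero k_def])
    moreover have "(norm (L2_of (phi u \<mu>\<^sub>0))) ^ 4 = mass\<^sup>2"
      unfolding mass_norm[symmetric] by (simp flip: power_mult)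
    ultimately show ?thesis by (simp add: kappa_def k_def mass_norm)
  qed
  show ?thesis
  proof (intro exI[of _ "min \<delta>1 \<delta>2"] conjI allI impI)
    show "{\<alpha>\<^sub>0 - min \<delta>1 \<delta>2<..<\<alpha>\<^sub>0 + min \<delta>1 \<delta>2} \<subseteq> J"
      by (auto intro!: J)
  qed (use \<delta>1(1) \<delta>2(1) main in auto)
qed

end
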